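(* Let $\kappa<1$ and an integer $k\ge1$ be fixed. For arbitrary real $D,Q,R\ge2$, for all except at most $O\left(D^2R(\log R)^2/\log D\right)$ primes $p\in[Q,2Q]$, the following holds: for every divisor $m$ of $p-1$ such that $d=(p-1)/m$ is odd and $3\le d\le D$, \[ M_{2k}(p,m)=a(k)+O\left(DR^{-\kappa}+Dp^{-1/2+o(1)}\right)\quad\text{and}\quad M^-_{2k}(p,m)=a(k)+O\left(DR^{-\kappa}+Dp^{-1/2+o(1)}\right), \] where implied constants depend only on $k,\kappa$, and $o(1)$ denotes a quantity tending to $0$ as $p\to\infty$.
   Context: For a prime $p$ and a divisor $m$ of $p-1$, let $d=(p-1)/m$, let $\mathcal G_m\subseteq\mathbb F_p^*$ be the unique multiplicative subgroup of index $m$ (order $d$), and let $\mathcal X_{p,m}$ be the group of multiplicative characters of $\mathbb F_p^*$ trivial on $\mathcal G_m$ (viewed as Dirichlet characters modulo $p$). Let $\mathcal X_{p,m}^-=\{\chi\in\mathcal X_{p,m}:\chi(-1)=-1\}$. Define \[ M_\nu(p,m)=\frac1m\sum_{\substack{\chi\in\mathcal X_{p,m}\\ \chi\ \text{non-principal}}}|L(1,\chi)|^\nu,\qquad M_\nu^-(p,m)=\frac{1}{\#\mathcal X_{p,m}^-}\sum_{\chi\in\mathcal X_{p,m}^-}|L(1,\chi)|^\nu, \] where $L(s,\chi)$ is the Dirichlet $L$-function. Let $\tau_k(n)$ be the number of ordered $k$-tuples of positive integers with product $n$, and $a(k)=\sum_{n\ge1}\tau_k(n)^2/n^2$. *)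

theory Defs
  imports "HOL-Analysis.Analysis"
begin

definition dchar :: "nat \<Rightarrow> (nat \<Rightarrow> complex) \<Rightarrow> bool" where
  "dchar p c \<longleftrightarrow> c 1 = 1 \<and> (\<forall>a b. c (a * b) = c a * c b) \<and>
     (\<forall>n. c (n + p) = c n) \<and> (\<forall>n. c n = 0 \<longleftrightarrow> p dvd n)"

definition principal_char :: "nat \<Rightarrow> (nat \<Rightarrow> complex) \<Rightarrow> bool" where
  "principal_char p c \<longleftrightarrow> (\<forall>n. coprime n p \<longrightarrow> c n = 1)"

text \<open>The subgroup of index m of F_p^*: the m-th powers (residues in 1..p-1).\<close>
definition Gsub :: "nat \<Rightarrow> nat \<Rightarrow> nat set" where
  "Gsub p m = {a \<in> {1..<p}. \<exists>x. coprime x p \<and> a = x ^ m mod p}"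

definition Xchars :: "nat \<Rightarrow> nat \<Rightarrow> (nat \<Rightarrow> complex) set" where
  "Xchars p m = {c. dchar p c \<and> (\<forall>g \<in> Gsub p m. c g = 1)}"

definition Xchars_minus :: "nat \<Rightarrow> nat \<Rightarrow> (nat \<Rightarrow> complex) set" where
  "Xchars_minus p m = {c \<in> Xchars p m. c (p - 1) = -1}"

definition L1 :: "(nat \<Rightarrow> complex) \<Rightarrow> complex" where
  "L1 c = lim (\<lambda>N. \<Sum>n=1..N. c n / of_nat n)"

definition Mnu :: "real \<Rightarrow> nat \<Rightarrow> nat \<Rightarrow> real" where
  "Mnu \<nu> p m = (1 / real m) *
     (\<Sum>c \<in> {c \<in> Xchars p m. \<not> principal_char p c}. cmod (L1 c) powr \<nu>)"

definition Mnu_minus :: "real \<Rightarrow> nat \<Rightarrow> nat \<Rightarrow> real" where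
  "Mnu_minus \<nu> p m = (1 / real (card (Xchars_minus p m))) *
     (\<Sum>c \<in> Xchars_minus p m. cmod (L1 c) powr \<nu>)"

definition tau :: "nat \<Rightarrow> nat \<Rightarrow> nat" where
  "tau k n = card {xs :: nat list. length xs = k \<and> prod_list xs = n}"

definition a_const :: "nat \<Rightarrow> real" where
  "a_const k = (\<Sum>n. real (tau k (Suc n)) ^ 2 / real (Suc n) ^ 2)"

end

theory Submission
  imports Defs "HOL-Number_Theory.Number_Theory" "HOL-Library.Discrete_Functions"
begin

text \<open>
  Truncating \<open>L(1, \<chi>)\<close> at \<open>p\<^sup>2\<close> costs only \<open>O(1/p)\<close>, since the partial sums of a non-principal character
  are bounded by \<open>p\<close>. Orthogonality then turns the \<open>2k\<close>-th moment into the sum of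
  \<open>\<tau>\<^sub>k(a) \<tau>\<^sub>k(b) / (a b)\<close> over pairs with \<open>a\<^sup>d \<equiv> b\<^sup>d (mod p)\<close> (minus those with
  \<open>(-a)\<^sup>d \<equiv> b\<^sup>d\<close> for the odd characters). The diagonal gives \<open>a(k)\<close>. The off-diagonal pairs lie in at most
  \<open>2d\<close> lattices \<open>a \<equiv> u b (mod p)\<close> of determinant \<open>p\<close>. A dyadic box of area \<open>T\<close> contains
  \<open>O(1 + T/p)\<close> primitive points of such a lattice, so if no off-diagonal pair has \<open>a b \<le> R\<close>, each lattice
  contributes \<open>O(R\<^bsup>-\<kappa>\<^esup> + p\<^bsup>-1/2\<^esup>)\<close>. A prime with a pair \<open>a b \<le> R\<close> divides one of the nonzero integers
  \<open>a\<^bsup>2d\<^esup> - b\<^bsup>2d\<^esup>\<close>, and counting the prime divisors of these bounds the exceptional set.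
  In particular the \<open>o(1)\<close> in the exponent can be taken to be \<open>0\<close>.
\<close>

text \<open>Truncating at p^2 lets \<open>a\<close> and \<open>b\<close> run up to H = p^(2k), so a
  bound n^eps for \<open>tau k n\<close> puts a factor H^(2 eps) = p^(4 k eps) in front of the T/p
  part of the lattice count; eps <= 1/(8k) still leaves p^(-1/2). A second constraint, kappa < 1 -
  eps, turns the 1 in O(1 + T/p) into a convergent geometric series over the boxes instead of a
  power of log p. The box count rests on separation of slopes, so it needs primitive points:
  multiples of one point share its slope. A general pair is divided by its gcd, which is prime to p,
  at the price of a convergent sum. Since this division shrinks a b, the inequality a b > R must be
  known for the reduced pair, and so the exceptional set is defined by all pairs of small product.
  The exponent 2d comes from the odd characters: both a^d = b^d and (-a)^d = b^d imply a^(2d) =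
  b^(2d) modulo p, so one exceptional set serves both moments.\<close>

subsection \<open>The divisor bound\<close>

text \<open>The contribution of one small prime to the divisor bound. With l = \<epsilon> ln 2 the
  right side is at least (1 + 1/l)(1 + a l), and the products 1 * 1 and (1/l) * (a l) alone give 1 +
  a.\<close>

lemma Suc_le_const_times_two_powr:
  fixes \<epsilon> :: real
  assumes "\<epsilon> > 0"
  shows "real (Suc a) \<le> (1 + 1 / (\<epsilon> * ln 2)) * (2 powr \<epsilon>) ^ a"
proof -
  define l where "l = \<epsilon> * ln 2"
  have l: "l > 0" using assms by (simp add: l_def)
  have "1 + real a * l \<le> exp (real a * l)"
    by (rule exp_ge_add_one_self)
  also have "\<dots> = (2 powr \<epsilon>) ^ a"
    by (simp add: powr_def l_def exp_of_nat_mult)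
  finally have le: "1 + real a * l \<le> (2 powr \<epsilon>) ^ a" .
  have "real (Suc a) \<le> (1 + 1 / l) * (1 + real a * l)"
    using l by (simp add: field_simps)
  also have "\<dots> \<le> (1 + 1 / l) * (2 powr \<epsilon>) ^ a"
    using le l by (intro mult_left_mono) auto
  finally show ?thesis by (simp add: l_def)
qed

lemma card_divisors_prime_power_mult_le:
  fixes p y :: nat
  assumes "prime p" "y > 0"
  shows "card {d. d dvd p ^ a * y} \<le> Suc a * card {d. d dvd y}"
proof -
  have "{d. d dvd p ^ a * y} \<subseteq> (\<lambda>(i, e). p ^ i * e) ` ({..a} \<times> {d. d dvd y})"
  proof
    fix d assume "d \<in> {d. d dvd p ^ a * y}"
    then obtain b c where bc: "d = b * c" "b dvd p ^ a" "c dvd y"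
      using division_decomp by blast
    then obtain i where "i \<le> a" "b = p ^ i"
      using divides_primepow_nat[OF assms(1)] by blast
    with bc show "d \<in> (\<lambda>(i, e). p ^ i * e) ` ({..a} \<times> {d. d dvd y})"
      by (intro image_eqI[of _ _ "(i, c)"]) auto
  qed
  then have "card {d. d dvd p ^ a * y} \<le> card ((\<lambda>(i, e). p ^ i * e) ` ({..a} \<times> {d. d dvd y}))"
    using assms by (intro card_mono finite_imageI finite_cartesian_product) auto
  also have "\<dots> \<le> card ({..a} \<times> {d. d dvd y})"
    using assms by (intro card_image_le finite_cartesian_product) auto
  finally show ?thesis by (simp add: card_cartesian_product)
qed

text \<open>Compare the factor a + 1 of each exact prime power p^a with p^(a \<epsilon>). Once
  p^\<epsilon> >= 2 the former is at most 2^a, hence no constant is lost; each of the fewer than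
  \<open>P\<close> smaller primes loses at most \<open>K\<close>. The total loss
  \<open>K ^ P\<close> is independent of n.\<close>

lemma card_divisors_le_powr:
  fixes \<epsilon> :: real
  assumes "\<epsilon> > 0"
  shows "\<exists>C\<ge>1. \<forall>n::nat. n > 0 \<longrightarrow> real (card {d. d dvd n}) \<le> C * real n powr \<epsilon>"
proof -
  define K where "K = 1 + 1 / (\<epsilon> * ln 2)"
  define P where "P = nat \<lceil>2 powr (1 / \<epsilon>)\<rceil>"
  define s where "s n = card {q \<in> {..<P}. prime q \<and> q dvd n}" for n :: nat
  have K: "K \<ge> 1" using assms by (simp add: K_def)
  \<comment> \<open>Strong induction on n, splitting off the full power of one prime;
    \<open>s n\<close> counts the lossy primes met so far.\<close>
  have *: "real (card {d. d dvd n}) \<le> K ^ s n * real n powr \<epsilon>" if "n > 0" for n :: nat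
    using that
  proof (induction n rule: less_induct)
    case (less n)
    show ?case
    proof (cases "n = 1")
      case True
      then show ?thesis using K by simp
    next
      case False
      then obtain p where p: "prime p" "p dvd n" using prime_factor_nat by blast
      define a where "a = multiplicity p n"
      obtain y where y: "n = p ^ a * y" "\<not> p dvd y"
        using multiplicity_decompose'[of n p] p less.prems unfolding a_def
        by (metis not_prime_unit not_gr_zero)
      have y0: "y > 0" using y less.prems by (cases "y = 0") auto
      have a0: "a > 0" using p y by (cases "a = 0") auto
      have p2: "p \<ge> 2" using p prime_ge_2_nat by blast
      have "1 < p ^ a" using p2 a0 by (intro one_less_power) auto
      then have "y < n" using y y0 by simp
      have IH: "real (card {d. d dvd y}) \<le> K ^ s y * real y powr \<epsilon>"
        using less.IH[OF \<open>y < n\<close> y0] .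
      have pw: "real (p ^ a) powr \<epsilon> = (real p powr \<epsilon>) ^ a"
        using p2 by (simp add: powr_power powr_realpow[symmetric] powr_powr mult_ac)
      have ny: "real n powr \<epsilon> = (real p powr \<epsilon>) ^ a * real y powr \<epsilon>"
        using y by (simp add: powr_mult pw[symmetric])
      have "real (Suc a) * K ^ s y \<le> K ^ s n * (real p powr \<epsilon>) ^ a"
      proof (cases "p < P")
        case True
        have "{q \<in> {..<P}. prime q \<and> q dvd n} = insert p {q \<in> {..<P}. prime q \<and> q dvd y}"
          using y p True a0 prime_dvd_power primes_dvd_imp_eq
          by (auto simp: prime_dvd_mult_iff) blast
        then have sn: "s n = Suc (s y)" using y by (simp add: s_def)
        have "real (Suc a) \<le> K * (2 powr \<epsilon>) ^ a"
          unfolding K_def by (rule Suc_le_const_times_two_powr[OF assms])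
        also have "\<dots> \<le> K * (real p powr \<epsilon>) ^ a"
          using K p2 assms by (intro mult_left_mono power_mono powr_mono2) auto
        finally show ?thesis using K sn
          by (simp add: mult_ac)
      next
        case False
        have "2 powr (1 / \<epsilon>) \<le> real p" using False by (simp add: P_def not_less)
        then have "(2 powr (1 / \<epsilon>)) powr \<epsilon> \<le> real p powr \<epsilon>"
          using assms by (intro powr_mono2) auto
        then have "2 \<le> real p powr \<epsilon>" using assms by (simp add: powr_powr)
        then have "2 ^ a \<le> (real p powr \<epsilon>) ^ a" by (intro power_mono) auto
        moreover have "real (Suc a) \<le> 2 ^ a"
          using less_exp[of a] by (metis Suc_leI of_nat_le_iff of_nat_numeral of_nat_power)
        ultimately have 1: "real (Suc a) \<le> (real p powr \<epsilon>) ^ a" by linarith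
        have "s y \<le> s n" unfolding s_def using y by (intro card_mono) auto
        then have 2: "K ^ s y \<le> K ^ s n" using K by (intro power_increasing) auto
        have "real (Suc a) * K ^ s y \<le> (real p powr \<epsilon>) ^ a * K ^ s n"
          using 1 2 K by (intro mult_mono) auto
        then show ?thesis by (simp add: mult_ac)
      qed
      then have "real (Suc a) * K ^ s y * real y powr \<epsilon> \<le> K ^ s n * real n powr \<epsilon>"
        unfolding ny by (metis mult.assoc mult_right_mono powr_ge_zero)
      moreover have "real (card {d. d dvd n}) \<le> real (Suc a * card {d. d dvd y})"
        unfolding y using card_divisors_prime_power_mult_le[OF p(1) y0] of_nat_le_iff by blast
      moreover have "real (Suc a * card {d. d dvd y}) \<le> real (Suc a) * (K ^ s y * real y powr \<epsilon>)"
        using IH unfolding of_nat_mult by (intro mult_left_mono) auto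
      ultimately show ?thesis by (simp add: mult.assoc)
    qed
  qed
  have "real (card {d. d dvd n}) \<le> K ^ P * real n powr \<epsilon>" if "n > 0" for n :: nat
  proof -
    have "s n \<le> card {..<P}" unfolding s_def by (intro card_mono) auto
    then have "K ^ s n \<le> K ^ P" using K by (intro power_increasing) auto
    then show ?thesis using *[OF that] by (meson mult_right_mono order.trans powr_ge_zero)
  qed
  moreover have "K ^ P \<ge> 1" using K by simp
  ultimately show ?thesis by blast
qed

section \<open>Ordered factorisations\<close>

lemma prod_list_eq_imp_set_subset_divisors:
  "prod_list xs = n \<Longrightarrow> set xs \<subseteq> {d. d dvd (n::nat)}"
  by (induction xs arbitrary: n) (auto intro: dvd_mult)

lemma finite_prod_list_eq:
  assumes "n > (0::nat)"
  shows "finite {xs. length xs = k \<and> prod_list xs = n}"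
  by (rule finite_subset[OF _ finite_lists_length_eq[of "{d. d dvd n}" k]])
     (use assms prod_list_eq_imp_set_subset_divisors in auto)

lemma tau_le_card_divisors_power:
  assumes "n > 0"
  shows "tau k n \<le> card {d. d dvd n} ^ k"
  unfolding tau_def
  by (subst card_lists_length_eq[symmetric])
     (use assms prod_list_eq_imp_set_subset_divisors finite_lists_length_eq[of "{d. d dvd n}" k]
       in \<open>auto intro!: card_mono\<close>)

text \<open>A factorisation into k factors is a k-tuple of divisors, so the divisor bound is applied
  with exponent \<epsilon>/k and raised to the k-th power.\<close>

lemma tau_le_powr:
  fixes \<epsilon> :: real
  assumes "\<epsilon> > 0" "k \<ge> 1"
  shows "\<exists>C\<ge>1. \<forall>n>0. real (tau k n) \<le> C * real n powr \<epsilon>"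
proof -
  obtain C where C: "C \<ge> 1" "\<And>n::nat. n > 0 \<Longrightarrow> real (card {d. d dvd n}) \<le> C * real n powr (\<epsilon> / k)"
    using card_divisors_le_powr[of "\<epsilon> / k"] assms by auto
  have "real (tau k n) \<le> C ^ k * real n powr \<epsilon>" if "n > 0" for n
  proof -
    have "real (tau k n) \<le> real (card {d. d dvd n}) ^ k"
      using tau_le_card_divisors_power[OF that] by (metis of_nat_le_iff of_nat_power)
    also have "\<dots> \<le> (C * real n powr (\<epsilon> / k)) ^ k"
      using C(2)[OF that] by (intro power_mono) auto
    also have "\<dots> = C ^ k * real n powr \<epsilon>"
      using assms that by (simp add: power_mult_distrib powr_power)
    finally show ?thesis .
  qed
  moreover have "C ^ k \<ge> 1" using C by simp
  ultimately show ?thesis by blast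
qed

subsection \<open>Short lattice points\<close>

text \<open>Pigeonhole: half-open cells of length \<delta> starting at \<open>lo\<close> hold at
  most one point each, and the cell numbers run from 0 to \<open>M\<close>.\<close>

lemma card_separated_le:
  fixes S :: "real set"
  assumes "\<delta> > 0" "lo \<le> hi" "S \<subseteq> {lo..hi}"
    and sep: "\<And>x y. x \<in> S \<Longrightarrow> y \<in> S \<Longrightarrow> x \<noteq> y \<Longrightarrow> \<bar>x - y\<bar> \<ge> \<delta>"
  shows "finite S" "real (card S) \<le> 1 + (hi - lo) / \<delta>"
proof -
  define \<phi> where "\<phi> x = nat \<lfloor>(x - lo) / \<delta>\<rfloor>" for x
  define M where "M = nat \<lfloor>(hi - lo) / \<delta>\<rfloor>"
  have inj: "inj_on \<phi> S"
  proof (rule inj_onI, rule ccontr)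
    fix x y assume xy: "x \<in> S" "y \<in> S" "\<phi> x = \<phi> y" "x \<noteq> y"
    have "(x - lo) / \<delta> \<ge> 0" "(y - lo) / \<delta> \<ge> 0" using xy assms by auto
    then have "\<lfloor>(x - lo) / \<delta>\<rfloor> = \<lfloor>(y - lo) / \<delta>\<rfloor>"
      using xy(3) unfolding \<phi>_def by (metis eq_nat_nat_iff zero_le_floor)
    then have "\<bar>(x - lo) / \<delta> - (y - lo) / \<delta>\<bar> < 1" by linarith
    then have "\<bar>(x - y) / \<delta>\<bar> < 1" by (simp add: diff_divide_distrib)
    then have "\<bar>x - y\<bar> < \<delta>" using assms(1) by (simp add: abs_divide)
    with sep[OF xy(1,2,4)] show False by simp
  qed
  have sub: "\<phi> ` S \<subseteq> {..M}"
    using assms(1,3) unfolding \<phi>_def M_def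
    by (auto intro!: nat_mono floor_mono divide_right_mono)
  show "finite S" using inj sub by (meson finite_atMost finite_imageD finite_subset)
  have "card S \<le> card {..M}" using inj sub by (metis card_image card_mono finite_atMost)
  then have "real (card S) \<le> 1 + real M" by simp
  also have "real M \<le> (hi - lo) / \<delta>" unfolding M_def using assms by simp
  finally show "real (card S) \<le> 1 + (hi - lo) / \<delta>" by simp
qed

lemma real_le_two_times_power_iff: "real a \<le> 2 * 2 ^ i \<longleftrightarrow> a \<le> 2 * 2 ^ i"
  using of_nat_le_numeral_power_cancel_iff[of a "num.Bit0 num.One" "Suc i"] by simp

text \<open>Uniqueness of lowest terms: a primitive point is determined by its slope.\<close>

lemma coprime_cross_mult_eq:
  fixes a b a' b' :: nat
  assumes "coprime a b" "coprime a' b'" "a * b' = a' * b" 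
  shows "a = a'" "b = b'"
proof -
  have "a dvd a'" using assms by (metis coprime_dvd_mult_left_iff dvd_triv_left)
  moreover have "a' dvd a" using assms by (metis coprime_dvd_mult_left_iff dvd_triv_left)
  ultimately show "a = a'" by (rule dvd_antisym)
  have "b dvd b'" using assms by (metis coprime_dvd_mult_right_iff coprime_commute dvd_triv_right)
  moreover have "b' dvd b" using assms by (metis coprime_dvd_mult_right_iff coprime_commute dvd_triv_right)
  ultimately show "b = b'" by (rule dvd_antisym)
qed

text \<open>Distinct primitive points of the lattice \<open>a \<equiv> u b (mod p)\<close> have slopes that differ by at
  least \<open>p / (b b')\<close>, because the determinant \<open>a b' - a' b\<close> is a nonzero multiple of \<open>p\<close>.\<close>

lemma card_primitive_points_dyadic_box_le:
  fixes p u i j :: nat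
  assumes "p > 0"
    and P: "P \<subseteq> {(a, b). coprime a b \<and> [a = u * b] (mod p) \<and> 2 ^ i \<le> a \<and> a < 2 * 2 ^ i
                        \<and> 2 ^ j \<le> b \<and> b < 2 * 2 ^ j}"
  shows "real (card P) \<le> 1 + 6 * 2 ^ (i + j) / real p"
proof -
  define r where "r = (\<lambda>(a, b). real a / real b :: real)"
  \<comment> \<open>The separation p / (b b') at its smallest in the box, where b and b' are below 2
    * 2^j.\<close>
  define \<delta> where "\<delta> = real p / (4 * (2 ^ j * 2 ^ j))"
  have \<delta>: "\<delta> > 0" using assms by (simp add: \<delta>_def)
  have inj: "inj_on r P"
  proof (rule inj_onI, clarify)
    fix a b a' b' assume *: "(a, b) \<in> P" "(a', b') \<in> P" "r (a, b) = r (a', b')"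
    have pos: "b > 0" "b' > 0"
      using * P by (auto intro: less_le_trans[of 0 "2 ^ j"])
    from * pos have "real a * real b' = real a' * real b" by (simp add: r_def field_simps)
    then have "a * b' = a' * b" by (metis of_nat_eq_iff of_nat_mult)
    with coprime_cross_mult_eq * P show "a = a' \<and> b = b'" by blast
  qed
  have sep: "\<delta> \<le> \<bar>x - y\<bar>" if xy: "x \<in> r ` P" "y \<in> r ` P" "x \<noteq> y" for x y
  proof -
    obtain a b a' b' where ab: "(a, b) \<in> P" "(a', b') \<in> P" "x = a / b" "y = a' / b'"
      using xy(1,2) by (fastforce simp: r_def)
    have pos: "b > 0" "b' > 0"
      using ab P by (auto intro: less_le_trans[of 0 "2 ^ j"])
    have "[int a = int u * int b] (mod int p)" "[int a' = int u * int b'] (mod int p)"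
      using ab P by (auto simp: cong_int_iff simp flip: of_nat_mult)
    then have "[int a * int b' = (int u * int b) * int b'] (mod int p)"
      "[int a' * int b = (int u * int b') * int b] (mod int p)"
      by (auto intro: cong_mult)
    then have "[int a * int b' = int a' * int b] (mod int p)"
      by (simp add: mult.assoc mult.commute[of "int b"] cong_def)
    then have dv: "int p dvd int a * int b' - int a' * int b" by (simp add: cong_iff_dvd_diff)
    have "real a * real b' \<noteq> real a' * real b" using xy(3) ab pos by (simp add: field_simps)
    then have "int a * int b' - int a' * int b \<noteq> 0"
      by (metis eq_iff_diff_eq_0 of_int_of_nat_eq of_int_mult)
    with dv have "int p \<le> \<bar>int a * int b' - int a' * int b\<bar>"
      by (metis abs_of_nat dvd_imp_le_int)
    then have "real_of_int (int p) \<le> real_of_int \<bar>int a * int b' - int a' * int b\<bar>"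
      by (simp only: of_int_le_iff)
    then have "real p \<le> \<bar>real a * real b' - real a' * real b\<bar>" by simp
    then have "real p / (real b * real b') \<le> \<bar>real a * real b' - real a' * real b\<bar> / (real b * real b')"
      using pos by (intro divide_right_mono) auto
    also have "\<dots> = \<bar>x - y\<bar>"
    proof -
      have "x - y = (real a * real b' - real a' * real b) / (real b * real b')"
        using pos by (simp add: ab field_simps)
      then show ?thesis using pos by (simp add: abs_divide abs_mult)
    qed
    finally have 1: "real p / (real b * real b') \<le> \<bar>x - y\<bar>" .
    have "b \<le> 2 * 2 ^ j" "b' \<le> 2 * 2 ^ j" using ab P by auto
    then have "real b \<le> 2 * 2 ^ j" "real b' \<le> 2 * 2 ^ j"
      by (simp_all only: real_le_two_times_power_iff)
    then have "real b * real b' \<le> (2 * 2 ^ j) * (2 * 2 ^ j)" by (intro mult_mono) auto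
    then have "\<delta> \<le> real p / (real b * real b')"
      unfolding \<delta>_def using pos by (intro divide_left_mono) auto
    with 1 show ?thesis by simp
  qed
  \<comment> \<open>The extreme slopes of the box. Their difference is (3/2) 2^i / 2^j, and division
    by \<delta> produces the constant 6.\<close>
  define lo where "lo = 2 ^ i / (2 * 2 ^ j :: real)"
  define hi where "hi = 2 * 2 ^ i / (2 ^ j :: real)"
  have sub: "r ` P \<subseteq> {lo..hi}"
  proof
    fix x assume "x \<in> r ` P"
    then obtain a b where ab: "(a, b) \<in> P" "x = a / b" by (fastforce simp: r_def)
    then have "2 ^ i \<le> a" "a \<le> 2 * 2 ^ i" "2 ^ j \<le> b" "b \<le> 2 * 2 ^ j" using P by auto
    then have le: "2 ^ i \<le> real a" "real a \<le> 2 * 2 ^ i" "2 ^ j \<le> real b" "real b \<le> 2 * 2 ^ j"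
      by (simp_all only: real_le_two_times_power_iff numeral_power_le_of_nat_cancel_iff)
    have "0 < real b" using le(3) by (rule less_le_trans[rotated]) simp
    with le show "x \<in> {lo..hi}"
      by (auto simp: ab lo_def hi_def intro!: frac_le)
  qed
  have "lo \<le> hi" by (simp add: lo_def hi_def field_simps)
  then have "real (card (r ` P)) \<le> 1 + (hi - lo) / \<delta>"
    by (intro card_separated_le(2) \<delta> sub sep)
  also have "(hi - lo) / \<delta> = 6 * 2 ^ (i + j) / real p"
    using assms by (simp add: hi_def lo_def \<delta>_def field_simps power_add)
  finally show ?thesis using inj by (simp add: card_image)
qed

lemma sum_pair_power:
  fixes q :: real
  shows "(\<Sum>(i,j)\<in>{..I}\<times>{..I}. q ^ (i + j)) = (\<Sum>i\<le>I. q ^ i)\<^sup>2"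
  by (simp add: power_add power2_eq_square sum_product sum.cartesian_product)

text \<open>A box with t = i + j contributes at most (1 + 6 * 2^t / p) 2^(-t \<theta>). A nonempty
  box has 2^t > R/4, so 2^(-t \<theta>) <= (4/R)^\<kappa> 2^(t (\<kappa> - \<theta>)), which is
  summable over all boxes because \<kappa> < \<theta>. The other part grows like 2^(t (1 -
  \<theta>)) / p and is governed by the largest boxes, whose sides are about H.\<close>

lemma sum_primitive_points_le:
  fixes p u H :: nat and R \<kappa> \<theta> :: real
  assumes "p > 0" "R > 0" "0 \<le> \<kappa>" "\<kappa> < \<theta>" "\<theta> < 1" "H > 0"
    and P: "P \<subseteq> {(a, b). a \<in> {1..H} \<and> b \<in> {1..H} \<and> coprime a b \<and> [a = u * b] (mod p)
                    \<and> R < real a * real b}"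
  shows "(\<Sum>(a,b)\<in>P. (real a * real b) powr (- \<theta>)) \<le>
           4 powr \<kappa> * (1 / (1 - 2 powr (\<kappa> - \<theta>)))\<^sup>2 * R powr (-\<kappa>) +
           6 * (2 powr (1 - \<theta>) / (2 powr (1 - \<theta>) - 1))\<^sup>2 * real H powr (2 * (1 - \<theta>)) / real p"
proof -
  define I where "I = floor_log H"
  define \<phi> where "\<phi> = (\<lambda>(a, b). (floor_log a, floor_log b))"
  define q1 where "q1 = 2 powr (\<kappa> - \<theta>)"
  define q2 where "q2 = 2 powr (1 - \<theta>)"
  have q1: "0 < q1" "q1 < 1" using assms by (auto simp: q1_def powr_less_one)
  have q2: "1 < q2" using assms by (auto simp: q2_def)
  have finP: "finite P"
    by (rule finite_subset[of _ "{1..H} \<times> {1..H}"]) (use P in auto)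
  have sub: "\<phi> ` P \<subseteq> {..I} \<times> {..I}"
    using P by (auto simp: \<phi>_def I_def intro!: floor_log_le_iff)
  have box: "(\<Sum>(a,b)\<in>{x \<in> P. \<phi> x = (i, j)}. (real a * real b) powr (- \<theta>))
      \<le> (4 / R) powr \<kappa> * q1 ^ (i + j) + 6 / real p * q2 ^ (i + j)" for i j
  proof (cases "{x \<in> P. \<phi> x = (i, j)} = {}")
    case True
    then show ?thesis using q1 q2 by (simp only: sum.empty) auto
  next
    case False
    define B where "B = {x \<in> P. \<phi> x = (i, j)}"
    define t where "t = i + j"
    have Bprop: "2 ^ i \<le> a \<and> a < 2 * 2 ^ i \<and> 2 ^ j \<le> b \<and> b < 2 * 2 ^ j" if "(a, b) \<in> B" for a b
      using that P floor_log_exp2_le[of a] floor_log_exp2_le[of b]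
        floor_log_exp2_gt[of a] floor_log_exp2_gt[of b]
      by (auto simp: B_def \<phi>_def)
    have card: "real (card B) \<le> 1 + 6 * 2 ^ t / real p"
      unfolding t_def
      by (rule card_primitive_points_dyadic_box_le[where u = u])
         (use assms Bprop in \<open>auto simp: B_def\<close>)
    obtain a b where ab: "(a, b) \<in> B" using False by (auto simp: B_def)
    \<comment> \<open>A single point in the box forces 2^t > R/4; this is how R enters the
      estimate.\<close>
    have "R < real a * real b" using ab P by (auto simp: B_def)
    also have "\<dots> \<le> (2 * 2 ^ i) * (2 * 2 ^ j)"
    proof (intro mult_mono)
      have "a \<le> 2 * 2 ^ i" "b \<le> 2 * 2 ^ j" using Bprop[OF ab] by simp_all
      then show "real a \<le> 2 * 2 ^ i" "real b \<le> 2 * 2 ^ j"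
        by (simp_all only: real_le_two_times_power_iff)
    qed auto
    finally have Rt: "R < 4 * 2 ^ t" by (simp add: t_def power_add)
    have "(real a * real b) powr (- \<theta>) \<le> (2 ^ t) powr (- \<theta>)" if "(a, b) \<in> B" for a b
    proof (rule powr_mono2')
      have "2 ^ i \<le> real a" "2 ^ j \<le> real b"
        using Bprop[OF that] by simp_all
      then have "2 ^ i * 2 ^ j \<le> real a * real b" by (intro mult_mono) auto
      then show "2 ^ t \<le> real a * real b" by (simp add: t_def power_add)
    qed (use assms in auto)
    then have "(\<Sum>(a,b)\<in>B. (real a * real b) powr (- \<theta>)) \<le> real (card B) * (2 ^ t) powr (- \<theta>)"
      by (intro sum_bounded_above) auto
    also have "\<dots> \<le> (1 + 6 * 2 ^ t / real p) * (2 ^ t) powr (- \<theta>)"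
      using card by (intro mult_right_mono) auto
    also have "\<dots> = (2 ^ t) powr (- \<theta>) + 6 / real p * (2 ^ t * (2 ^ t) powr (- \<theta>))"
      by (simp add: algebra_simps)
    also have "2 ^ t * (2 ^ t) powr (- \<theta>) = q2 ^ t"
    proof -
      have "(2::real) ^ t = 2 powr real t" by (simp add: powr_realpow)
      then show ?thesis
        by (simp add: q2_def powr_powr powr_power flip: powr_add) (simp add: algebra_simps)
    qed
    also have "(2 ^ t) powr (- \<theta>) = ((2::real) ^ t) powr (- \<kappa>) * q1 ^ t"
    proof -
      have "(2::real) ^ t = 2 powr real t" by (simp add: powr_realpow)
      then show ?thesis
        by (simp add: q1_def powr_powr powr_power flip: powr_add) (simp add: algebra_simps)
    qed
    also have "((2::real) ^ t) powr (- \<kappa>) \<le> (R / 4) powr (- \<kappa>)"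
      using Rt assms by (intro powr_mono2') auto
    also have "(R / 4) powr (- \<kappa>) = (4 / R) powr \<kappa>"
      using assms by (simp add: powr_divide powr_minus field_simps)
    finally show ?thesis using q1 by (simp add: B_def t_def)
  qed
  have "(\<Sum>(a,b)\<in>P. (real a * real b) powr (- \<theta>)) =
      (\<Sum>y\<in>{..I}\<times>{..I}. \<Sum>(a,b)\<in>{x \<in> P. \<phi> x = y}. (real a * real b) powr (- \<theta>))"
    by (rule sum.group[symmetric]) (use finP sub in auto)
  also have "\<dots> \<le> (\<Sum>(i,j)\<in>{..I}\<times>{..I}. (4 / R) powr \<kappa> * q1 ^ (i + j) + 6 / real p * q2 ^ (i + j))"
    by (intro sum_mono) (use box in auto)
  also have "\<dots> = (4 / R) powr \<kappa> * (\<Sum>(i,j)\<in>{..I}\<times>{..I}. q1 ^ (i + j))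
                + 6 / real p * (\<Sum>(i,j)\<in>{..I}\<times>{..I}. q2 ^ (i + j))"
    by (simp add: sum.distrib sum_distrib_left case_prod_unfold)
  also have "\<dots> = (4 / R) powr \<kappa> * (\<Sum>i\<le>I. q1 ^ i)\<^sup>2 + 6 / real p * (\<Sum>i\<le>I. q2 ^ i)\<^sup>2"
    by (simp only: sum_pair_power)
  finally have le: "(\<Sum>(a,b)\<in>P. (real a * real b) powr (- \<theta>)) \<le>
      (4 / R) powr \<kappa> * (\<Sum>i\<le>I. q1 ^ i)\<^sup>2 + 6 / real p * (\<Sum>i\<le>I. q2 ^ i)\<^sup>2" .
  have "(\<Sum>i\<le>I. q1 ^ i) = (1 - q1 ^ Suc I) / (1 - q1)"
    using q1 by (simp add: sum_gp0)
  also have "\<dots>\<^sup>2 \<le> (1 / (1 - q1))\<^sup>2"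
    using q1 power_le_one[of q1 "Suc I"] by (intro power_mono divide_right_mono divide_nonneg_nonneg) auto
  finally have s1: "(\<Sum>i\<le>I. q1 ^ i)\<^sup>2 \<le> (1 / (1 - q1))\<^sup>2" .
  have "(\<Sum>i\<le>I. q2 ^ i) = (q2 ^ Suc I - 1) / (q2 - 1)"
    using q2 by (simp add: sum_gp0) (metis minus_diff_eq minus_divide_divide)
  also have "\<dots>\<^sup>2 \<le> (q2 * real H powr (1 - \<theta>) / (q2 - 1))\<^sup>2"
  proof (intro power_mono divide_right_mono divide_nonneg_nonneg)
    have "q2 ^ I = (2 ^ I) powr (1 - \<theta>)"
      by (simp add: q2_def powr_powr powr_power mult.commute flip: powr_realpow)
    also have "\<dots> \<le> real H powr (1 - \<theta>)"
    proof (rule powr_mono2)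
      show "2 ^ I \<le> real H" unfolding I_def using floor_log_exp2_le[of H] assms(6) by simp
    qed (use assms in auto)
    finally have "q2 * q2 ^ I \<le> q2 * real H powr (1 - \<theta>)" using q2 by (intro mult_left_mono) auto
    then show "q2 ^ Suc I - 1 \<le> q2 * real H powr (1 - \<theta>)" by simp
  qed (use q2 one_le_power[of q2 "Suc I"] in auto)
  also have "\<dots> = (q2 / (q2 - 1))\<^sup>2 * real H powr (2 * (1 - \<theta>))"
    using assms by (simp add: power_mult_distrib power_divide powr_power mult.commute)
  finally have s2: "(\<Sum>i\<le>I. q2 ^ i)\<^sup>2 \<le> (q2 / (q2 - 1))\<^sup>2 * real H powr (2 * (1 - \<theta>))" .
  have "(4 / R) powr \<kappa> = 4 powr \<kappa> * R powr (- \<kappa>)"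
    using assms by (simp add: powr_divide powr_minus field_simps)
  then have "(4 / R) powr \<kappa> * (\<Sum>i\<le>I. q1 ^ i)\<^sup>2 \<le> 4 powr \<kappa> * (1 / (1 - q1))\<^sup>2 * R powr (- \<kappa>)"
    using mult_left_mono[OF s1, of "4 powr \<kappa> * R powr (- \<kappa>)"] by (simp add: mult_ac)
  moreover have "6 / real p * (\<Sum>i\<le>I. q2 ^ i)\<^sup>2
      \<le> 6 * (q2 / (q2 - 1))\<^sup>2 * real H powr (2 * (1 - \<theta>)) / real p"
    using mult_left_mono[OF s2, of "6 / real p"] by (simp add: mult_ac)
  ultimately show ?thesis using le unfolding q1_def q2_def by linarith
qed

text \<open>Each pair is g times a primitive pair with the same u, and its weight carries an extra
  g^(-2 \<theta>). Since 2 \<theta> >= 3/2, the sum over g is bounded by a constant.\<close>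

lemma sum_congruent_points_le:
  fixes p u H :: nat and R \<kappa> \<theta> :: real
  assumes "prime p" "R > 0" "0 \<le> \<kappa>" "\<kappa> < \<theta>" "3 / 4 \<le> \<theta>" "\<theta> < 1" "H > 0"
    and S: "S \<subseteq> {(a, b). a \<in> {1..H} \<and> b \<in> {1..H} \<and> \<not> p dvd a \<and> \<not> p dvd b \<and> [a = u * b] (mod p)}"
    and R: "\<And>a b. a \<in> {1..H} \<Longrightarrow> b \<in> {1..H} \<Longrightarrow> \<not> p dvd a \<Longrightarrow> \<not> p dvd b \<Longrightarrow> [a = u * b] (mod p)
                   \<Longrightarrow> a \<noteq> b \<Longrightarrow> R < real a * real b"
    and neq: "\<And>a b. (a, b) \<in> S \<Longrightarrow> a \<noteq> b"
  shows "(\<Sum>(a,b)\<in>S. (real a * real b) powr (- \<theta>)) \<le> (\<Sum>n. real (Suc n) powr (- (3 / 2))) *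
          (4 powr \<kappa> * (1 / (1 - 2 powr (\<kappa> - \<theta>)))\<^sup>2 * R powr (-\<kappa>) +
           6 * (2 powr (1 - \<theta>) / (2 powr (1 - \<theta>) - 1))\<^sup>2 * real H powr (2 * (1 - \<theta>)) / real p)"
proof -
  define P where "P = {(a, b). a \<in> {1..H} \<and> b \<in> {1..H} \<and> coprime a b \<and> [a = u * b] (mod p)
                    \<and> R < real a * real b}"
  define w where "w = (\<lambda>(a, b). (real a * real b) powr (- \<theta>))"
  define \<psi> where "\<psi> = (\<lambda>(g::nat, (a::nat, b::nat)). (g * a, g * b))"
  have finP: "finite P"
    by (rule finite_subset[of _ "{1..H} \<times> {1..H}"]) (auto simp: P_def)
  have sub: "S \<subseteq> \<psi> ` ({1..H} \<times> P)"
  proof clarify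
    fix a b assume ab: "(a, b) \<in> S"
    then have ab': "a \<in> {1..H}" "b \<in> {1..H}" "\<not> p dvd a" "\<not> p dvd b" "[a = u * b] (mod p)" "a \<noteq> b"
      using S neq by auto
    define g where "g = gcd a b"
    have g0: "g > 0" "g \<le> H" using ab' by (auto simp: g_def intro: gcd_le1_nat[THEN order.trans])
    obtain x y where xy: "a = g * x" "b = g * y" "coprime x y"
      using gcd_coprime_exists[of a b] g0 unfolding g_def by (metis mult.commute neq0_conv)
    \<comment> \<open>p does not divide \<open>a\<close>, hence not its divisor g, and g can be
      cancelled from the congruence.\<close>
    have cp: "coprime g p"
      using ab' xy assms(1) by (metis coprime_commute dvd_mult2 prime_imp_coprime_nat)
    have "[g * x = g * (u * y)] (mod p)" using ab' xy by (simp add: mult_ac)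
    then have cong: "[x = u * y] (mod p)" using cp by (simp add: cong_mult_lcancel_nat)
    have x: "x \<in> {1..H}" "y \<in> {1..H}"
      using ab' xy g0 by (auto simp: Suc_le_eq intro: order.trans[rotated])
    \<comment> \<open>The assumption is used for the reduced pair, which still satisfies x \<noteq>
      y; the inequality for (a, b) itself would be too weak.\<close>
    have "R < real x * real y"
      using x cong ab' xy by (intro R) auto
    then have "(x, y) \<in> P" using x cong xy by (auto simp: P_def)
    then show "(a, b) \<in> \<psi> ` ({1..H} \<times> P)"
      using xy g0 by (intro image_eqI[of _ _ "(g, (x, y))"]) (auto simp: \<psi>_def)
  qed
  have summ: "summable (\<lambda>n. real (Suc n) powr (- (3 / 2)))"
    using summable_real_powr_iff[of "- (3 / 2)"]
    by (subst summable_Suc_iff[of "\<lambda>n. real n powr (- (3 / 2))"]) simp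
  \<comment> \<open>The weights are nonnegative, so enlarging S and then summing over preimages
    under \<open>\<psi>\<close> can only increase the total.\<close>
  have "(\<Sum>x\<in>S. w x) \<le> (\<Sum>x\<in>\<psi> ` ({1..H} \<times> P). w x)"
    using sub finP by (intro sum_mono2) (auto simp: w_def)
  also have "\<dots> \<le> (\<Sum>x\<in>{1..H} \<times> P. (w \<circ> \<psi>) x)"
    using finP by (intro sum_image_le) (auto simp: w_def \<psi>_def)
  also have "\<dots> = (\<Sum>x\<in>{1..H} \<times> P. real (fst x) powr (- (2 * \<theta>)) * w (snd x))"
  proof (rule sum.cong)
    fix x assume "x \<in> {1..H} \<times> P"
    then obtain g a b where x: "x = (g, (a, b))" "g > 0" by (cases x) auto
    have "real g * real a * (real g * real b) = (real g * real g) * (real a * real b)"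
      by (simp add: mult_ac)
    then show "(w \<circ> \<psi>) x = real (fst x) powr (- (2 * \<theta>)) * w (snd x)"
      using x by (simp add: w_def \<psi>_def powr_mult flip: powr_add)
  qed simp
  also have "\<dots> = (\<Sum>g=1..H. real g powr (- (2 * \<theta>))) * (\<Sum>x\<in>P. w x)"
    by (simp add: sum_product sum.cartesian_product case_prod_unfold)
  also have "\<dots> \<le> (\<Sum>n. real (Suc n) powr (- (3 / 2))) * (\<Sum>x\<in>P. w x)"
  proof (rule mult_right_mono)
    have "(\<Sum>g=1..H. real g powr (- (2 * \<theta>))) \<le> (\<Sum>g=1..H. real g powr (- (3 / 2)))"
      using assms by (intro sum_mono powr_mono) auto
    also have "\<dots> = (\<Sum>n<H. real (Suc n) powr (- (3 / 2)))"
      by (rule sum.reindex_bij_witness[of _ Suc "\<lambda>n. n - 1"]) auto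
    also have "\<dots> \<le> (\<Sum>n. real (Suc n) powr (- (3 / 2)))"
      by (intro sum_le_suminf summ) auto
    finally show "(\<Sum>g=1..H. real g powr (- (2 * \<theta>))) \<le> (\<Sum>n. real (Suc n) powr (- (3 / 2)))" .
  qed (auto intro!: sum_nonneg simp: w_def)
  also have "\<dots> \<le> (\<Sum>n. real (Suc n) powr (- (3 / 2))) *
          (4 powr \<kappa> * (1 / (1 - 2 powr (\<kappa> - \<theta>)))\<^sup>2 * R powr (-\<kappa>) +
           6 * (2 powr (1 - \<theta>) / (2 powr (1 - \<theta>) - 1))\<^sup>2 * real H powr (2 * (1 - \<theta>)) / real p)"
    unfolding w_def using assms prime_gt_0_nat
    by (intro mult_left_mono sum_primitive_points_le[where u = u] suminf_nonneg summ) (auto simp: P_def)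
  finally show ?thesis by (simp add: w_def)
qed

text \<open>There are at most \<open>n\<close> residues \<open>u\<close> with \<open>u\<^sup>n \<equiv> 1\<close>, so the pairs split into \<open>n\<close> lattices.\<close>

lemma sum_power_congruent_points_le:
  fixes p n H :: nat and R \<kappa> \<theta> :: real
  assumes "prime p" "n > 0" "R > 0" "0 \<le> \<kappa>" "\<kappa> < \<theta>" "3 / 4 \<le> \<theta>" "\<theta> < 1" "H > 0"
    and R: "\<And>a b. a > 0 \<Longrightarrow> b > 0 \<Longrightarrow> a \<noteq> b \<Longrightarrow> [a ^ n = b ^ n] (mod p) \<Longrightarrow> R < real a * real b"
  defines "S \<equiv> {(a, b). a \<in> {1..H} \<and> b \<in> {1..H} \<and> \<not> p dvd a \<and> \<not> p dvd b \<and> a \<noteq> b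
                   \<and> [a ^ n = b ^ n] (mod p)}"
  shows "(\<Sum>(a,b)\<in>S. (real a * real b) powr (- \<theta>)) \<le> real n * ((\<Sum>n. real (Suc n) powr (- (3 / 2))) *
          (4 powr \<kappa> * (1 / (1 - 2 powr (\<kappa> - \<theta>)))\<^sup>2 * R powr (-\<kappa>) +
           6 * (2 powr (1 - \<theta>) / (2 powr (1 - \<theta>) - 1))\<^sup>2 * real H powr (2 * (1 - \<theta>)) / real p))"
    (is "_ \<le> real n * ?B")
proof -
  define U where "U = {u \<in> {..<p}. [u ^ n = 1] (mod p)}"
  define T where "T u = {(a, b). (a, b) \<in> S \<and> [a = u * b] (mod p)}" for u
  have finS: "finite S"
    by (rule finite_subset[of _ "{1..H} \<times> {1..H}"]) (auto simp: S_def)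
  have p0: "p > 0" using assms(1) prime_gt_0_nat by blast
  have cover: "S \<subseteq> (\<Union>u\<in>U. T u)"
  proof clarify
    fix a b assume ab: "(a, b) \<in> S"
    then have "coprime p b" and cong: "[a ^ n = b ^ n] (mod p)"
      using assms(1) by (auto simp: S_def intro: prime_imp_coprime_nat)
    then have b: "coprime b p" by (simp add: coprime_commute)
    from b obtain v where v: "[b * v = 1] (mod p)" using cong_solve_coprime_nat[OF b] by auto
    \<comment> \<open>The quotient a/b modulo p; its n-th power is 1 because a^n and b^n
      agree.\<close>
    define u where "u = (a * v) mod p"
    have uab: "[a = u * b] (mod p)"
    proof -
      have "[u * b = a * v * b] (mod p)" unfolding u_def by (intro cong_mult) (auto simp: cong_def)
      also have "[a * v * b = a * (b * v)] (mod p)" by (simp add: mult_ac)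
      also have "[a * (b * v) = a * 1] (mod p)" using v by (intro cong_mult cong_refl)
      finally show ?thesis by (simp add: cong_sym)
    qed
    have "[u ^ n * b ^ n = 1 * b ^ n] (mod p)"
      using cong_pow[OF uab, of n] cong by (simp add: power_mult_distrib cong_def)
    then have "[u ^ n = 1] (mod p)"
      using b cong_mult_rcancel_nat[of "b ^ n" p] by (metis coprime_power_left_iff)
    then have "u \<in> U" using p0 by (simp add: U_def u_def)
    then show "(a, b) \<in> (\<Union>u\<in>U. T u)" using ab uab by (auto simp: T_def)
  qed
  have pn: "[a ^ n = b ^ n] (mod p)" if "u \<in> U" "[a = u * b] (mod p)" for u a b
  proof -
    have "[a ^ n = u ^ n * b ^ n] (mod p)"
      using cong_pow[OF that(2), of n] by (simp add: power_mult_distrib)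
    also have "[u ^ n * b ^ n = 1 * b ^ n] (mod p)"
      using that(1) by (intro cong_mult cong_refl) (auto simp: U_def)
    finally show ?thesis by simp
  qed
  have bound: "(\<Sum>(a,b)\<in>T u. (real a * real b) powr (- \<theta>)) \<le> ?B" if u: "u \<in> U" for u
  proof (rule sum_congruent_points_le[where u = u and S = "T u"])
    show "R < real a * real b" if "a \<in> {1..H}" "b \<in> {1..H}" "[a = u * b] (mod p)" "a \<noteq> b" for a b
      using that pn[OF u that(3)] by (intro R) auto
  qed (use assms in \<open>auto simp: T_def S_def\<close>)
  \<comment> \<open>Needed to replace \<open>card U\<close> by n. The lattice u = 1 always occurs,
    and \<open>?B\<close> dominates its nonnegative sum.\<close>
  have B0: "0 \<le> ?B"
  proof -
    have "0 \<le> (\<Sum>(a,b)\<in>T 1. (real a * real b) powr (- \<theta>))" by (intro sum_nonneg) auto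
    also have "\<dots> \<le> ?B"
      using assms(1,2) prime_gt_1_nat by (intro bound) (auto simp: U_def)
    finally show ?thesis .
  qed
  define w where "w = (\<lambda>(a, b). (real a * real b) powr (- \<theta>))"
  have finT: "finite (T u)" for u by (rule finite_subset[OF _ finS]) (auto simp: T_def)
  have finU: "finite U" by (simp add: U_def)
  have "(\<Sum>x\<in>S. w x) \<le> (\<Sum>x\<in>snd ` Sigma U T. w x)"
    using cover finT finU by (intro sum_mono2 finite_imageI finite_SigmaI) (force simp: w_def)+
  also have "\<dots> \<le> (\<Sum>x\<in>Sigma U T. (w \<circ> snd) x)"
    using finT finU by (intro sum_image_le finite_SigmaI) (auto simp: w_def)
  also have "\<dots> = (\<Sum>u\<in>U. \<Sum>x\<in>T u. w x)"
    using finT finU by (simp add: sum.Sigma case_prod_unfold)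
  also have "\<dots> \<le> real (card U) * ?B"
    using bound by (intro sum_bounded_above) (auto simp: w_def)
  also have "\<dots> \<le> real n * ?B"
    using roots_mod_prime_bound[OF assms(1,2), of 1] B0 unfolding U_def
    by (intro mult_right_mono) auto
  finally show ?thesis by (simp add: w_def)
qed

subsection \<open>Characters trivial on a subgroup\<close>

lemma dchar_power: "dchar p c \<Longrightarrow> c (a ^ n) = c a ^ n"
  by (induction n) (auto simp: dchar_def)

lemma dchar_cong:
  assumes "dchar p c" "[a = b] (mod p)"
  shows "c a = c b"
proof -
  have shift: "c (n + t * p) = c n" for n t
  proof (induction t)
    case (Suc t)
    have "c (n + Suc t * p) = c ((n + t * p) + p)" by (simp add: algebra_simps)
    also have "\<dots> = c n" using assms(1) Suc unfolding dchar_def by metis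
    finally show ?case .
  qed simp
  have "c n = c (n mod p)" for n
    using shift[of "n mod p" "n div p"] by simp
  then show ?thesis using assms(2) unfolding cong_def by metis
qed

section \<open>Primitive roots, dual group and orthogonality\<close>

lemma prime_primitive_root_exists:
  fixes p :: nat
  assumes "prime p" "odd p"
  obtains g where "coprime p g" "ord p g = p - 1" "\<And>n. \<not> p dvd n \<Longrightarrow> \<exists>i. [g ^ i = n] (mod p)"
proof -
  obtain g where g: "\<forall>k>0. residue_primroot (p ^ k) g"
    using residue_primroot_odd_prime_power_exists[OF assms] .
  then have g: "residue_primroot p g" by (metis power_one_right zero_less_one)
  then have cp: "coprime p g" and ord: "ord p g = p - 1"
    using assms by (auto simp: residue_primroot_def totient_prime)
  have p1: "p > 1" using assms prime_gt_1_nat by blast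
  have bij: "bij_betw (\<lambda>i. g ^ i mod p) {..<totient p} (totatives p)"
    by (rule residue_primroot_is_generator) (use g p1 in auto)
  have "\<exists>i. [g ^ i = n] (mod p)" if "\<not> p dvd n" for n
  proof -
    have "coprime p n" using assms that prime_imp_coprime_nat by blast
    then have "n mod p \<in> totatives p"
      using p1 that by (auto simp: totatives_def coprime_commute dvd_eq_mod_eq_0 intro: less_imp_le)
    then obtain i where "g ^ i mod p = n mod p"
      using bij by (auto simp: bij_betw_def) (metis (no_types, lifting) imageE)
    then show ?thesis by (auto simp: cong_def)
  qed
  with cp ord show ?thesis using that by blast
qed

text \<open>Multiplication by a primitive m-th root w permutes the roots, so the sum is fixed by the
  factor w^n; this factor differs from 1 unless m divides n.\<close>

lemma sum_power_roots_of_unity: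
  assumes "m > 0"
  shows "(\<Sum>z | z ^ m = (1::complex). z ^ n) = (if m dvd n then of_nat m else 0)"
proof -
  have fin: "finite {z::complex. z ^ m = 1}" using assms by (simp add: finite_nth_roots)
  show ?thesis
  proof (cases "m dvd n")
    case True
    then obtain t where "n = m * t" by blast
    then have "(\<Sum>z | z ^ m = (1::complex). z ^ n) = (\<Sum>z | z ^ m = (1::complex). 1)"
      by (intro sum.cong) (auto simp: power_mult)
    then show ?thesis using True assms by (simp add: card_roots_unity_eq)
  next
    case False
    define w where "w = cis (2 * pi / m)"
    have wm: "w ^ m = 1" using assms unfolding w_def by (subst Complex.DeMoivre) simp
    have "w ^ n \<noteq> 1"
    proof
      assume "w ^ n = 1"
      then have "w ^ (n mod m) = 1"
        using wm by (metis mult_1 power_add power_mult power_one mod_mult_div_eq add.commute)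
      then have "cis (2 * pi * real (n mod m) / real m) = cis (2 * pi * real 0 / real m)"
        by (simp add: w_def Complex.DeMoivre mult_ac)
      then have "n mod m = 0"
        using Complex.bij_betw_roots_unity[OF assms] assms
        unfolding bij_betw_def inj_on_def by (metis (no_types, lifting) lessThan_iff mod_less_divisor)
      with False show False by auto
    qed
    have "(\<Sum>z | z ^ m = (1::complex). z ^ n) = (\<Sum>z | z ^ m = (1::complex). (w * z) ^ n)"
      by (rule sum.reindex_bij_witness[of _ "\<lambda>z. w * z" "\<lambda>z. z / w"])
         (use wm in \<open>auto simp: w_def power_mult_distrib power_divide\<close>)
    also have "\<dots> = w ^ n * (\<Sum>z | z ^ m = (1::complex). z ^ n)"
      by (simp add: power_mult_distrib sum_distrib_left)
    finally have "(w ^ n - 1) * (\<Sum>z | z ^ m = (1::complex). z ^ n) = 0" by (simp add: algebra_simps)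
    then show ?thesis using False \<open>w ^ n \<noteq> 1\<close> by simp
  qed
qed

text \<open>A character is determined by z = c g at a primitive root, and triviality on m-th powers
  gives z^m = 1. Conversely z raised to the discrete logarithm is a character: the logarithm is
  determined modulo p - 1, hence modulo m.\<close>

lemma bij_betw_Xchars_roots_of_unity:
  assumes "prime p" "m dvd p - 1" "m > 0" "coprime p g" "ord p g = p - 1"
    and gen: "\<And>n. \<not> p dvd n \<Longrightarrow> \<exists>i. [g ^ i = n] (mod p)"
  shows "bij_betw (\<lambda>c. c g) (Xchars p m) {z. z ^ m = 1}"
proof -
  have p1: "p > 1" using assms prime_gt_1_nat by blast
  have ng: "\<not> p dvd g" using assms(4) p1 by (metis coprime_absorb_left nat_neq_iff nat_dvd_1_iff_1)
  \<comment> \<open>An arbitrary choice of discrete logarithm; \<open>f_eq\<close> below shows that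
    any other exponent gives the same value.\<close>
  define ind where "ind n = (SOME i. [g ^ i = n] (mod p))" for n
  have ind: "[g ^ ind n = n] (mod p)" if "\<not> p dvd n" for n
    unfolding ind_def using gen[OF that] by (rule someI_ex)
  have pw: "z ^ i = z ^ j" if "z ^ m = (1::complex)" "[g ^ i = g ^ j] (mod p)" for z i j
  proof -
    have "[i = j] (mod (p - 1))" using that(2) assms(4,5) order_divides_expdiff by metis
    then have "[i = j] (mod m)" using assms(2) cong_dvd_modulus_nat by blast
    then have "i mod m = j mod m" by (simp add: cong_def)
    moreover have "z ^ n = z ^ (n mod m)" for n
      using that(1) by (metis mult_1 power_add power_mult power_one mod_mult_div_eq mult.right_neutral)
    ultimately show ?thesis by metis
  qed
  define f where "f z n = (if p dvd n then 0 else z ^ ind n)" for z :: complex and n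
  have f_eq: "f z n = z ^ i" if "z ^ m = 1" "[g ^ i = n] (mod p)" for z n i
  proof -
    have "coprime p (g ^ i)" using assms(4) by simp
    then have "coprime p n" using that(2) cong_imp_coprime coprime_commute by metis
    then have "\<not> p dvd n" using p1 by (metis coprime_absorb_left nat_neq_iff nat_dvd_1_iff_1)
    then have "[g ^ ind n = g ^ i] (mod p)" using ind that(2) by (metis cong_sym cong_trans)
    then show ?thesis using pw[OF that(1)] \<open>\<not> p dvd n\<close> by (simp add: f_def)
  qed
  show ?thesis
  proof (rule bij_betw_byWitness[where f' = f])
    show "\<forall>c\<in>Xchars p m. f (c g) = c"
    proof
      fix c assume "c \<in> Xchars p m"
      then have c: "dchar p c" by (simp add: Xchars_def)
      show "f (c g) = c"
      proof
        fix n show "f (c g) n = c n"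
          using c ind[of n] dchar_cong[OF c ind[of n]] dchar_power[OF c]
          by (cases "p dvd n") (auto simp: f_def dchar_def)
      qed
    qed
    show "\<forall>z\<in>{z. z ^ m = 1}. f z g = z"
      using f_eq[of _ 1 g] by simp
    show "(\<lambda>c. c g) ` Xchars p m \<subseteq> {z. z ^ m = 1}"
    proof clarify
      fix c assume c: "c \<in> Xchars p m"
      have d: "dchar p c" using c by (simp add: Xchars_def)
      have "\<not> p dvd g ^ m" using ng assms(1) prime_dvd_power_nat by blast
      then have "g ^ m mod p \<in> Gsub p m"
        using assms(4) p1 by (auto simp: Gsub_def coprime_commute dvd_eq_mod_eq_0)
      then have "c (g ^ m mod p) = 1" using c by (simp add: Xchars_def)
      then have "c (g ^ m) = 1" using dchar_cong[OF d, of "g ^ m mod p" "g ^ m"] by (simp add: cong_def)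
      then show "c g ^ m = 1" using dchar_power[OF d] by simp
    qed
    show "f ` {z. z ^ m = 1} \<subseteq> Xchars p m"
    proof clarify
      fix z :: complex assume z: "z ^ m = 1"
      have z0: "z \<noteq> 0" using z assms(3) zero_power[of m] by (metis zero_neq_one)
      have 1: "f z 1 = 1" using f_eq[OF z, of 0 1] by simp
      have 2: "f z (a * b) = f z a * f z b" for a b
      proof (cases "p dvd a * b")
        case True
        then show ?thesis using assms(1) by (auto simp: f_def prime_dvd_mult_iff)
      next
        case False
        then have nd: "\<not> p dvd a" "\<not> p dvd b" by auto
        have "[g ^ (ind a + ind b) = a * b] (mod p)"
          unfolding power_add by (intro cong_mult ind nd)
        from f_eq[OF z this] show ?thesis using nd by (simp add: f_def power_add)
      qed
      have 3: "f z (n + p) = f z n" for n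
      proof (cases "p dvd n")
        case False
        then have "[g ^ ind n = n + p] (mod p)" using ind by (simp add: cong_def)
        from f_eq[OF z this] show ?thesis using False by (simp add: f_def)
      qed (simp add: f_def)
      have 4: "f z n = 0 \<longleftrightarrow> p dvd n" for n using z0 by (simp add: f_def)
      have 5: "f z a = 1" if a: "a \<in> Gsub p m" for a
      proof -
        obtain x where x: "coprime x p" "a = x ^ m mod p" using a by (auto simp: Gsub_def)
        have nx: "\<not> p dvd x" using x(1) p1 by (metis coprime_absorb_right nat_neq_iff nat_dvd_1_iff_1)
        have "[g ^ (ind x * m) = a] (mod p)"
          using cong_pow[OF ind[OF nx], of m] x(2) by (simp add: power_mult cong_def)
        from f_eq[OF z this] show ?thesis using z by (simp add: power_mult mult.commute)
      qed
      show "f z \<in> Xchars p m"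
        using 1 2 3 4 5 by (simp add: Xchars_def dchar_def)
    qed
  qed
qed

text \<open>For a = g^i and b = g^j each summand is a fixed power of c g, which runs through the
  m-th roots of unity. The sum survives exactly when i = j modulo m, that is, when a/b lies in the
  subgroup of order d, which is the set of solutions of x^d = 1.\<close>

lemma Xchars_orthogonality:
  assumes "prime p" "odd p" "m dvd p - 1" "d = (p - 1) div m"
  shows "finite (Xchars p m)" "card (Xchars p m) = m"
    "(\<Sum>c\<in>Xchars p m. c a * cnj (c b)) =
      (if \<not> p dvd a \<and> \<not> p dvd b \<and> [a ^ d = b ^ d] (mod p) then of_nat m else 0)"
proof -
  have p1: "p > 1" using assms prime_gt_1_nat by blast
  have m0: "m > 0" using assms p1 by (metis dvd_0_left_iff neq0_conv zero_less_diff)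
  have md: "p - 1 = m * d" using assms by simp
  have d0: "d > 0" using md p1 by (metis mult_0_right neq0_conv zero_less_diff)
  obtain g where g: "coprime p g" "ord p g = p - 1" "\<And>n. \<not> p dvd n \<Longrightarrow> \<exists>i. [g ^ i = n] (mod p)"
    using prime_primitive_root_exists[OF assms(1,2)] by metis
  have bij: "bij_betw (\<lambda>c. c g) (Xchars p m) {z. z ^ m = 1}"
    by (rule bij_betw_Xchars_roots_of_unity[OF assms(1,3) m0 g])
  have fin: "finite {z::complex. z ^ m = 1}" using m0 by (simp add: finite_nth_roots)
  show "finite (Xchars p m)" using bij fin bij_betw_finite by blast
  show "card (Xchars p m) = m" using bij_betw_same_card[OF bij] m0 by (simp add: card_roots_unity_eq)
  show "(\<Sum>c\<in>Xchars p m. c a * cnj (c b)) =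
      (if \<not> p dvd a \<and> \<not> p dvd b \<and> [a ^ d = b ^ d] (mod p) then of_nat m else 0)"
  proof (cases "p dvd a \<or> p dvd b")
    case True
    then have "(\<Sum>c\<in>Xchars p m. c a * cnj (c b)) = 0"
      by (intro sum.neutral) (auto simp: Xchars_def dchar_def)
    then show ?thesis using True by auto
  next
    case False
    then obtain i j where ij: "[g ^ i = a] (mod p)" "[g ^ j = b] (mod p)" using g(3) by metis
    \<comment> \<open>Conjugation is written as the power m - 1, which keeps all exponents natural
      numbers.\<close>
    have val: "c a * cnj (c b) = c g ^ (i + (m - 1) * j)" if c: "c \<in> Xchars p m" for c
    proof -
      have d: "dchar p c" using c by (simp add: Xchars_def)
      define z where "z = c g"
      have z: "z ^ m = 1" using bij c by (auto simp: bij_betw_def z_def)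
      have "cmod z ^ m = 1" using z by (metis norm_one norm_power)
      then have "cmod z = 1" using m0 power_eq_imp_eq_base[of "cmod z" m 1] by simp
      then have "z * cnj z = 1" by (simp add: complex_norm_square[symmetric])
      moreover have "z * z ^ (m - 1) = 1" using z m0 by (metis power_minus_mult mult.commute)
      ultimately have "cnj z = z ^ (m - 1)"
        by (metis mult_cancel_left zero_neq_one mult_zero_left)
      moreover have "c a = z ^ i" "c b = z ^ j"
        using dchar_cong[OF d ij(1)] dchar_cong[OF d ij(2)] dchar_power[OF d] by (auto simp: z_def)
      ultimately show ?thesis by (simp add: power_add power_mult z_def)
    qed
    have "(\<Sum>c\<in>Xchars p m. c a * cnj (c b)) = (\<Sum>c\<in>Xchars p m. c g ^ (i + (m - 1) * j))"
      using val by simp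
    also have "\<dots> = (\<Sum>z | z ^ m = 1. z ^ (i + (m - 1) * j))"
      by (rule sum.reindex_bij_betw[OF bij])
    also have "\<dots> = (if m dvd i + (m - 1) * j then of_nat m else 0)"
      by (rule sum_power_roots_of_unity[OF m0])
    also have "m dvd i + (m - 1) * j \<longleftrightarrow> [i = j] (mod m)"
    proof -
      have "m dvd i + (m - 1) * j \<longleftrightarrow> [i + (m - 1) * j = 0] (mod m)" by (simp add: cong_0_iff)
      also have "\<dots> \<longleftrightarrow> [i + (m - 1) * j + j = 0 + j] (mod m)" by (rule cong_add_rcancel_nat[symmetric])
      also have "i + (m - 1) * j + j = i + m * j" using m0 by (cases m) auto
      also have "[i + m * j = 0 + j] (mod m) \<longleftrightarrow> [i = j] (mod m)" by (simp add: cong_def)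
      finally show ?thesis .
    qed
    also have "[i = j] (mod m) \<longleftrightarrow> [d * i = d * j] (mod (p - 1))"
      using d0 unfolding md cong_def mult.commute[of m d] by (simp add: mod_mult_mult1)
    also have "\<dots> \<longleftrightarrow> [g ^ (d * i) = g ^ (d * j)] (mod p)"
      using order_divides_expdiff[OF g(1)] g(2) by simp
    also have "\<dots> \<longleftrightarrow> [a ^ d = b ^ d] (mod p)"
    proof -
      have "[g ^ (d * i) = a ^ d] (mod p)" "[g ^ (d * j) = b ^ d] (mod p)"
        using cong_pow[OF ij(1), of d] cong_pow[OF ij(2), of d] by (simp_all add: power_mult mult.commute[of d])
      then show ?thesis by (simp add: cong_def)
    qed
    finally show ?thesis using False by simp
  qed
qed

subsection \<open>Truncation of the L-series\<close>

text \<open>The difference of the harmonic number and the logarithm decreases from its first value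
  1.\<close>

lemma sum_inverse_le_ln:
  assumes "N > 0"
  shows "(\<Sum>n=1..N. 1 / real n) \<le> 1 + ln (real N)"
proof -
  obtain M where M: "N = Suc M" using assms by (cases N) auto
  have "harm (Suc M) - ln (real (Suc M)) \<le> harm (Suc 0) - ln (real (Suc 0))"
    using decseqD[OF decseq_harm_diff_ln, of 0 M] by simp
  then show ?thesis by (simp add: M harm_def inverse_eq_divide)
qed

lemma dchar_norm_le:
  assumes "prime p" "dchar p c"
  shows "norm (c n) \<le> 1"
proof (cases "p dvd n")
  case True
  then have "c n = 0" using assms unfolding dchar_def by blast
  then show ?thesis by simp
next
  case False
  have "c n ^ (p - 1) = c 1"
    using dchar_cong[OF assms(2) fermat_theorem[OF assms(1) False]] dchar_power[OF assms(2)] by simp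
  then have "norm (c n) ^ (p - 1) = 1"
    using assms(2) by (metis dchar_def norm_one norm_power)
  then show ?thesis
    using power_eq_imp_eq_base[of "norm (c n)" "p - 1" 1] prime_gt_1_nat[OF assms(1)] by simp
qed

text \<open>Multiplication by some \<open>a\<close> with c a \<noteq> 1 permutes the residues and
  multiplies the sum by c a.\<close>

lemma dchar_sum_period_eq_0:
  assumes "prime p" "dchar p c" "\<not> principal_char p c"
  shows "(\<Sum>n<p. c n) = 0"
proof -
  obtain a where a: "coprime a p" "c a \<noteq> 1" using assms(3) by (auto simp: principal_char_def)
  have p0: "p > 0" using assms(1) prime_gt_0_nat by blast
  have inj: "inj_on (\<lambda>n. a * n mod p) {..<p}"
  proof (rule inj_onI)
    fix x y assume "x \<in> {..<p}" "y \<in> {..<p}" "a * x mod p = a * y mod p"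
    then show "x = y"
      using cong_mult_lcancel_nat[OF a(1), of x y] by (simp add: cong_def)
  qed
  have bij: "bij_betw (\<lambda>n. a * n mod p) {..<p} {..<p}"
    unfolding bij_betw_def
  proof (intro conjI inj)
    show "(\<lambda>n. a * n mod p) ` {..<p} = {..<p}"
      using inj p0 by (intro endo_inj_surj) auto
  qed
  have "c a * (\<Sum>n<p. c n) = (\<Sum>n<p. c (a * n mod p))"
    unfolding sum_distrib_left
  proof (rule sum.cong)
    fix n
    have "c (a * n mod p) = c (a * n)" by (rule dchar_cong[OF assms(2)]) (simp add: cong_def)
    then show "c a * c n = c (a * n mod p)" using assms(2) by (simp add: dchar_def)
  qed simp
  also have "\<dots> = (\<Sum>n<p. c n)" by (rule sum.reindex_bij_betw[OF bij])
  finally have "(c a - 1) * (\<Sum>n<p. c n) = 0" by (simp add: algebra_simps)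
  then show ?thesis using a by simp
qed

text \<open>Complete periods cancel; fewer than p terms of modulus at most 1 remain.\<close>

lemma dchar_partial_sum_le:
  assumes "prime p" "dchar p c" "\<not> principal_char p c"
  shows "norm (\<Sum>n<N. c n) \<le> real p"
proof (induction N rule: less_induct)
  case (less N)
  have p0: "p > 0" using assms(1) prime_gt_0_nat by blast
  show ?case
  proof (cases "N < p")
    case True
    have "norm (\<Sum>n<N. c n) \<le> (\<Sum>n<N. 1)"
      by (intro sum_norm_le dchar_norm_le[OF assms(1,2)])
    then show ?thesis using True by simp
  next
    case False
    have "(\<Sum>n<M + p. c n) = (\<Sum>n<M. c n)" for M
    proof (induction M)
      case (Suc M)
      then show ?case using assms(2) by (simp add: dchar_def)
    qed (simp add: dchar_sum_period_eq_0[OF assms])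
    from this[of "N - p"] show ?thesis using less.IH[of "N - p"] False p0 by simp
  qed
qed

text \<open>Summation by parts. \<open>E\<close> is the weighted sum without its boundary term, and
  its increments A(M+1) (1/(M+1) - 1/(M+2)) telescope to B (1/(N+1) - 1/(M+1)). The boundary term is
  at most B/(M+1), so the two bounds add up to exactly B/(N+1).\<close>

lemma abel_sum_divide_index_le:
  fixes f :: "nat \<Rightarrow> complex"
  assumes "\<And>M. norm (\<Sum>n\<in>{N<..M}. f n) \<le> B" "N \<le> M"
  shows "norm (\<Sum>n\<in>{N<..M}. f n / of_nat n) \<le> B / (real N + 1)"
proof -
  define A where "A M = (\<Sum>n\<in>{N<..M}. f n)" for M
  define E where "E M = (\<Sum>n\<in>{N<..M}. f n / of_nat n) - A M / (of_nat M + 1)" for M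
  have A: "norm (A M) \<le> B" for M unfolding A_def by (rule assms)
  have "norm (E M) \<le> B * (1 / (real N + 1) - 1 / (real M + 1))"
    using assms(2)
  proof (induction M rule: dec_induct)
    case base
    then show ?case by (simp add: E_def A_def)
  next
    case (step M)
    have ins: "{N<..Suc M} = insert (Suc M) {N<..M}" using step by auto
    have As: "A (Suc M) = f (Suc M) + A M" by (simp add: A_def ins)
    have "E (Suc M) = E M + f (Suc M) / of_nat (Suc M) + A M / (of_nat M + 1) - A (Suc M) / (of_nat (Suc M) + 1)"
      by (simp add: E_def ins)
    also have "\<dots> = E M + A (Suc M) * (1 / (of_nat M + 1) - 1 / (of_nat M + 2))"
      unfolding As by (simp add: divide_inverse algebra_simps)
    also have "(1 / (of_nat M + 1) - 1 / (of_nat M + 2) :: complex) =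
        of_real (1 / (real M + 1) - 1 / (real M + 2))" by simp
    finally have "norm (E (Suc M)) \<le> norm (E M) + norm (A (Suc M)) * \<bar>1 / (real M + 1) - 1 / (real M + 2)\<bar>"
      by (metis norm_mult norm_of_real norm_triangle_ineq)
    also have "\<bar>1 / (real M + 1) - 1 / (real M + 2)\<bar> = 1 / (real M + 1) - 1 / (real M + 2)"
      by (simp add: field_simps)
    also have "norm (A (Suc M)) * (1 / (real M + 1) - 1 / (real M + 2)) \<le> B * (1 / (real M + 1) - 1 / (real M + 2))"
      by (intro mult_right_mono A) (simp add: field_simps)
    finally have "norm (E (Suc M)) \<le> B * (1 / (real N + 1) - 1 / (real M + 1)) + B * (1 / (real M + 1) - 1 / (real M + 2))"
      using step.IH by linarith
    also have "\<dots> = B * (1 / (real N + 1) - 1 / (real (Suc M) + 1))"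
      by (simp add: right_diff_distrib add.commute)
    finally show ?case .
  qed
  moreover have "norm (A M / (of_nat M + 1)) \<le> B / (real M + 1)"
  proof -
    have "norm (of_nat M + 1 :: complex) = real M + 1"
      by (metis norm_of_nat of_nat_Suc add.commute)
    then show ?thesis using A[of M] by (simp add: norm_divide divide_right_mono)
  qed
  moreover have "(\<Sum>n\<in>{N<..M}. f n / of_nat n) = E M + A M / (of_nat M + 1)" by (simp add: E_def)
  ultimately have "norm (\<Sum>n\<in>{N<..M}. f n / of_nat n) \<le>
      B * (1 / (real N + 1) - 1 / (real M + 1)) + B / (real M + 1)"
    by (metis add_mono norm_triangle_ineq order.trans)
  then show ?thesis by (simp add: right_diff_distrib)
qed

lemma L1_truncation:
  assumes "prime p" "dchar p c" "\<not> principal_char p c"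
  shows "norm (L1 c - (\<Sum>n=1..N. c n / of_nat n)) \<le> 2 * real p / (real N + 1)"
proof -
  define S where "S N = (\<Sum>n=1..N. c n / of_nat n)" for N
  \<comment> \<open>A block is the difference of two initial sums, each of modulus at most
    p.\<close>
  have part: "norm (\<Sum>n\<in>{N<..M}. c n) \<le> 2 * real p" for N M
  proof (cases "N \<le> M")
    case True
    have "{..<Suc M} = {..<Suc N} \<union> {N<..M}" 
      using True unfolding set_eq_iff Un_iff lessThan_iff greaterThanAtMost_iff by presburger
    moreover have "{..<Suc N} \<inter> {N<..M} = {}" by auto
    ultimately have "(\<Sum>n<Suc M. c n) = (\<Sum>n<Suc N. c n) + (\<Sum>n\<in>{N<..M}. c n)"
      by (metis finite_lessThan finite_greaterThanAtMost sum.union_disjoint)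
    then have "(\<Sum>n\<in>{N<..M}. c n) = (\<Sum>n<Suc M. c n) - (\<Sum>n<Suc N. c n)" by simp
    then show ?thesis
      using norm_triangle_ineq4[of "\<Sum>n<Suc M. c n" "\<Sum>n<Suc N. c n"]
        dchar_partial_sum_le[OF assms, of "Suc M"] dchar_partial_sum_le[OF assms, of "Suc N"]
      by simp
  qed simp
  have diff: "norm (S M - S N) \<le> 2 * real p / (real N + 1)" if "N \<le> M" for N M
  proof -
    have "{1..M} = {1..N} \<union> {N<..M}" using that by auto
    moreover have "{1..N} \<inter> {N<..M} = {}" by auto
    ultimately have "S M = S N + (\<Sum>n\<in>{N<..M}. c n / of_nat n)"
      unfolding S_def by (metis (no_types, lifting) finite_atLeastAtMost finite_greaterThanAtMost sum.union_disjoint)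
    then show ?thesis
      using abel_sum_divide_index_le[where f = c and N = N and M = M and B = "2 * real p"] part that by simp
  qed
  \<comment> \<open>\<open>L1\<close> is defined through \<open>lim\<close>, so convergence has to
    be established before the tail bound can be passed to the limit.\<close>
  have "Cauchy S"
  proof (rule metric_CauchyI)
    fix e :: real assume e: "e > 0"
    obtain K :: nat where K: "4 * real p / e < real K" using reals_Archimedean2 by blast
    have *: "norm (S M - S K) < e / 2" if "M \<ge> K" for M
    proof -
      have "4 * real p < e * (real K + 1)"
        using K e by (simp add: field_simps)
      then have "2 * real p / (real K + 1) < e / 2"
        by (simp add: field_simps)
      then show ?thesis using diff[OF that] by linarith
    qed
    have "dist (S M) (S M') < e" if "M \<ge> K" "M' \<ge> K" for M M'
      using *[OF that(1)] *[OF that(2)] by (metis dist_norm dist_triangle_half_l)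
    then show "\<exists>K. \<forall>M\<ge>K. \<forall>M'\<ge>K. dist (S M) (S M') < e" by blast
  qed
  then have "S \<longlonglongrightarrow> L1 c"
    unfolding L1_def S_def[symmetric] by (simp add: Cauchy_convergent_iff convergent_LIMSEQ_iff)
  then have "(\<lambda>M. norm (S M - S N)) \<longlonglongrightarrow> norm (L1 c - S N)" by (intro tendsto_intros)
  then have "norm (L1 c - S N) \<le> 2 * real p / (real N + 1)"
    by (rule LIMSEQ_le_const2) (use diff in blast)
  then show ?thesis by (simp add: S_def)
qed

lemma norm_dchar_sum_le:
  assumes "prime p" "dchar p c" "N > 0"
  shows "norm (\<Sum>n=1..N. c n / of_nat n) \<le> 1 + ln (real N)"
proof -
  have "norm (\<Sum>n=1..N. c n / of_nat n) \<le> (\<Sum>n=1..N. 1 / real n)"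
    using dchar_norm_le[OF assms(1,2)]
    by (intro sum_norm_le) (auto simp: norm_divide divide_right_mono)
  also have "\<dots> \<le> 1 + ln (real N)" by (rule sum_inverse_le_ln[OF assms(3)])
  finally show ?thesis .
qed

lemma abs_power_diff_le:
  fixes x y B :: real
  assumes "0 \<le> x" "x \<le> B" "0 \<le> y" "y \<le> B"
  shows "\<bar>x ^ n - y ^ n\<bar> \<le> real n * B ^ (n - 1) * \<bar>x - y\<bar>"
proof (induction n)
  case (Suc n)
  show ?case
  proof (cases "n = 0")
    case False
    have "x ^ Suc n - y ^ Suc n = x * (x ^ n - y ^ n) + y ^ n * (x - y)" by (simp add: algebra_simps)
    then have "\<bar>x ^ Suc n - y ^ Suc n\<bar> \<le> x * \<bar>x ^ n - y ^ n\<bar> + y ^ n * \<bar>x - y\<bar>"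
      using assms by (metis abs_mult abs_of_nonneg abs_triangle_ineq zero_le_power)
    also have "\<dots> \<le> B * (real n * B ^ (n - 1) * \<bar>x - y\<bar>) + B ^ n * \<bar>x - y\<bar>"
      using assms Suc by (intro add_mono mult_mono power_mono mult_right_mono) auto
    also have "B * (real n * B ^ (n - 1) * \<bar>x - y\<bar>) = real n * (B * B ^ (n - 1)) * \<bar>x - y\<bar>" by simp
    also have "B * B ^ (n - 1) = B ^ n" using False by (simp add: power_eq_if)
    finally show ?thesis by (simp add: algebra_simps)
  qed simp
qed simp

lemma dchar_moment_truncation:
  assumes "prime p" "dchar p c" "\<not> principal_char p c" "k \<ge> 1"
  shows "\<bar>norm (L1 c) powr (2 * real k) - norm (\<Sum>n=1..p\<^sup>2. c n / of_nat n) ^ (2 * k)\<bar>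
           \<le> 4 * real k * (3 + 2 * ln (real p)) ^ (2 * k) / real p"
proof -
  define S where "S = (\<Sum>n=1..p\<^sup>2. c n / of_nat n)"
  \<comment> \<open>A common bound for |S| <= 1 + ln (p^2) and for |L1 c| <= |S| + 2/p; the
    difference of the 2k-th powers is then at most 2k B^(2k) times 2/p.\<close>
  define B where "B = 3 + 2 * ln (real p)"
  have p2: "p \<ge> 2" using assms(1) prime_ge_2_nat by blast
  have B1: "B \<ge> 1" using p2 by (simp add: B_def)
  have S: "norm S \<le> 1 + 2 * ln (real p)"
    using norm_dchar_sum_le[OF assms(1,2), of "p\<^sup>2"] p2 by (simp add: S_def ln_realpow)
  have "norm (L1 c - S) \<le> 2 * real p / (real (p\<^sup>2) + 1)"
    unfolding S_def by (rule L1_truncation[OF assms(1-3)])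
  also have "\<dots> \<le> 2 * real p / real (p\<^sup>2)"
    using p2 by (intro divide_left_mono mult_pos_pos) (auto intro: add_nonneg_pos)
  also have "\<dots> = 2 / real p" using p2 by (simp add: power2_eq_square)
  finally have LS: "norm (L1 c - S) \<le> 2 / real p" .
  have "norm (L1 c) \<le> norm S + norm (L1 c - S)" by norm
  moreover have "2 / real p \<le> 1" using p2 by simp
  ultimately have L: "norm (L1 c) \<le> B" using S LS unfolding B_def by linarith
  have S': "norm S \<le> B" using S by (simp add: B_def)
  have "\<bar>norm (L1 c) - norm S\<bar> \<le> 2 / real p" using LS norm_triangle_ineq3[of "L1 c" S] by linarith
  have "\<bar>norm (L1 c) ^ (2 * k) - norm S ^ (2 * k)\<bar> \<le> real (2 * k) * B ^ (2 * k - 1) * \<bar>norm (L1 c) - norm S\<bar>"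
    by (rule abs_power_diff_le) (use L S' in auto)
  also have "\<dots> \<le> real (2 * k) * B ^ (2 * k) * (2 / real p)"
    using B1 \<open>\<bar>norm (L1 c) - norm S\<bar> \<le> 2 / real p\<close>
    by (intro mult_mono mult_left_mono power_increasing) auto
  finally have "\<bar>norm (L1 c) ^ (2 * k) - norm S ^ (2 * k)\<bar> \<le> 4 * real k * B ^ (2 * k) / real p" by simp
  \<comment> \<open>At a zero of \<open>L1\<close> the two powers agree because k >= 1;
    \<open>0 powr 0\<close> would be 0, not 1.\<close>
  moreover have "norm (L1 c) powr (2 * real k) = norm (L1 c) ^ (2 * k)"
    using powr_realpow'[of "norm (L1 c)" "2 * k"] assms(4) by simp
  ultimately show ?thesis by (simp add: S_def B_def)
qed

subsection \<open>Moments as correlation sums\<close>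

text \<open>The coefficient of a^(-s) in the k-th power of the Dirichlet polynomial with terms
  n^(-s), n <= N. For positive \<open>a\<close> it is at most \<open>tau k a\<close>, with equality
  as long as a <= N.\<close>

definition bounded_tau :: "nat \<Rightarrow> nat \<Rightarrow> nat \<Rightarrow> nat" where
  "bounded_tau N k a = card {xs. set xs \<subseteq> {1..N} \<and> length xs = k \<and> prod_list xs = a}"

lemma power_sum_eq_sum_lists:
  fixes h :: "'a \<Rightarrow> 'b::comm_semiring_1"
  assumes "finite A"
  shows "(\<Sum>n\<in>A. h n) ^ k = (\<Sum>xs | set xs \<subseteq> A \<and> length xs = k. prod_list (map h xs))"
proof (induction k)
  case 0
  have "{xs. set xs \<subseteq> A \<and> length xs = 0} = {[]}" by auto
  then show ?case by simp
next
  case (Suc k)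
  have inj: "inj_on (\<lambda>(xs, n). n # xs) ({xs. set xs \<subseteq> A \<and> length xs = k} \<times> A)"
    by (auto simp: inj_on_def)
  show ?case
    unfolding lists_length_Suc_eq sum.reindex[OF inj] power_Suc Suc.IH
    by (subst sum_product, subst sum.swap) (simp add: sum.cartesian_product case_prod_unfold)
qed

lemma prod_list_in_interval:
  fixes N :: nat
  assumes "set xs \<subseteq> {1..N}"
  shows "prod_list xs \<in> {1..N ^ length xs}"
  using assms
proof (induction xs)
  case (Cons x xs)
  then show ?case by (auto simp: Suc_le_eq intro: mult_le_mono)
qed simp

lemma dchar_prod_list:
  assumes "dchar p c"
  shows "prod_list (map (\<lambda>n. c n / of_nat n) xs) = c (prod_list xs) / of_nat (prod_list xs)"
  using assms by (induction xs) (auto simp: dchar_def)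

text \<open>Complete multiplicativity makes each product depend on the product of the indices alone,
  so the tuples are grouped by that product.\<close>

lemma dchar_sum_power:
  assumes "dchar p c"
  shows "(\<Sum>n=1..N. c n / of_nat n) ^ k =
    (\<Sum>a=1..N ^ k. of_real (real (bounded_tau N k a) / real a) * c a)"
proof -
  define Ls where "Ls = {xs. set xs \<subseteq> {1..N} \<and> length xs = k}"
  have fin: "finite Ls" unfolding Ls_def by (rule finite_lists_length_eq) simp
  have sub: "prod_list ` Ls \<subseteq> {1..N ^ k}"
    unfolding Ls_def using prod_list_in_interval by blast
  have "(\<Sum>n=1..N. c n / of_nat n) ^ k = (\<Sum>xs\<in>Ls. c (prod_list xs) / of_nat (prod_list xs))"
    by (simp add: power_sum_eq_sum_lists Ls_def dchar_prod_list[OF assms])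
  also have "\<dots> = (\<Sum>a=1..N ^ k. \<Sum>xs\<in>{xs \<in> Ls. prod_list xs = a}. c (prod_list xs) / of_nat (prod_list xs))"
    using fin sub by (intro sum.group[symmetric]) auto
  also have "\<dots> = (\<Sum>a=1..N ^ k. of_real (real (bounded_tau N k a) / real a) * c a)"
  proof (rule sum.cong)
    fix a
    have "{xs \<in> Ls. prod_list xs = a} = {xs. set xs \<subseteq> {1..N} \<and> length xs = k \<and> prod_list xs = a}"
      by (auto simp: Ls_def)
    then have "card {xs \<in> Ls. prod_list xs = a} = bounded_tau N k a" by (simp add: bounded_tau_def)
    then show "(\<Sum>xs\<in>{xs \<in> Ls. prod_list xs = a}. c (prod_list xs) / of_nat (prod_list xs)) =
        of_real (real (bounded_tau N k a) / real a) * c a" by simp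
  qed simp
  finally show ?thesis .
qed

lemma bounded_tau_le_tau:
  assumes "a > 0"
  shows "bounded_tau N k a \<le> tau k a"
  unfolding bounded_tau_def tau_def using finite_prod_list_eq[OF assms]
  by (intro card_mono) auto

lemma bounded_tau_eq_tau:
  assumes "a > 0" "a \<le> N"
  shows "bounded_tau N k a = tau k a"
proof -
  have "set xs \<subseteq> {1..N}" if "prod_list xs = a" for xs
  proof
    fix x assume "x \<in> set xs"
    then have "x dvd a" using prod_list_eq_imp_set_subset_divisors[OF that] by blast
    then show "x \<in> {1..N}" using assms dvd_imp_le[of x a] by (cases "x = 0") auto
  qed
  then have "{xs. set xs \<subseteq> {1..N} \<and> length xs = k \<and> prod_list xs = a} =
      {xs. length xs = k \<and> prod_list xs = a}" by blast
  then show ?thesis by (simp add: bounded_tau_def tau_def)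
qed

lemma dchar_moment_eq_double_sum:
  fixes N k :: nat
  assumes "dchar p c"
  defines "w \<equiv> \<lambda>a. real (bounded_tau N k a) / real a"
  shows "complex_of_real (norm (\<Sum>n=1..N. c n / of_nat n) ^ (2 * k)) =
    (\<Sum>a=1..N ^ k. \<Sum>b=1..N ^ k. of_real (w a * w b) * (c a * cnj (c b)))"
proof -
  define S where "S = (\<Sum>n=1..N. c n / of_nat n)"
  have "complex_of_real (norm S ^ (2 * k)) = S ^ k * cnj (S ^ k)"
  proof -
    have "complex_of_real (norm S ^ (2 * k)) = complex_of_real ((norm S)\<^sup>2) ^ k" by (simp add: power_mult)
    also have "\<dots> = (S * cnj S) ^ k" by (simp only: complex_norm_square)
    finally show ?thesis by (simp add: power_mult_distrib)
  qed
  also have "S ^ k = (\<Sum>a=1..N ^ k. of_real (w a) * c a)"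
    unfolding S_def w_def by (rule dchar_sum_power[OF assms(1)])
  finally show ?thesis
    unfolding S_def by (simp add: sum_product mult_ac)
qed

text \<open>The family of characters enters only through its mass \<open>M\<close> and its kernel
  \<delta>. This lets the full group and the odd characters share one computation.\<close>

lemma sum_dchar_moments:
  fixes N k :: nat
  assumes "finite Y" "\<And>c. c \<in> Y \<Longrightarrow> dchar p c"
    and orth: "\<And>a b. (\<Sum>c\<in>Y. c a * cnj (c b)) = of_real (M * \<delta> a b)"
  defines "w \<equiv> \<lambda>a. real (bounded_tau N k a) / real a"
  shows "(\<Sum>c\<in>Y. norm (\<Sum>n=1..N. c n / of_nat n) ^ (2 * k)) =
    M * (\<Sum>a=1..N ^ k. \<Sum>b=1..N ^ k. w a * w b * \<delta> a b)"
proof -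
  have "complex_of_real (\<Sum>c\<in>Y. norm (\<Sum>n=1..N. c n / of_nat n) ^ (2 * k)) =
      (\<Sum>c\<in>Y. \<Sum>a=1..N ^ k. \<Sum>b=1..N ^ k. of_real (w a * w b) * (c a * cnj (c b)))"
    unfolding of_real_sum w_def
    by (intro sum.cong refl dchar_moment_eq_double_sum[OF assms(2)])
  also have "\<dots> = (\<Sum>a=1..N ^ k. \<Sum>b=1..N ^ k. of_real (w a * w b) * (\<Sum>c\<in>Y. c a * cnj (c b)))"
    unfolding sum_distrib_left
    by (subst sum.swap, intro sum.cong refl, subst sum.swap, rule refl)
  also have "\<dots> = complex_of_real (M * (\<Sum>a=1..N ^ k. \<Sum>b=1..N ^ k. w a * w b * \<delta> a b))"
    unfolding orth by (simp add: sum_distrib_left mult_ac)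
  finally show ?thesis by (simp only: of_real_eq_iff)
qed

lemma principal_char_unique:
  assumes "dchar p c" "principal_char p c" "prime p"
  shows "c = (\<lambda>n. if p dvd n then 0 else 1)"
proof
  fix n show "c n = (if p dvd n then 0 else 1)"
  proof (cases "p dvd n")
    case True
    then show ?thesis using assms(1) unfolding dchar_def by simp
  next
    case False
    then have "coprime n p" using assms(3) prime_imp_coprime_nat coprime_commute by blast
    then show ?thesis using False assms(2) by (simp add: principal_char_def)
  qed
qed

text \<open>The residue p - 1 stands for -1. As c(-1) is 1 or -1, the factor (1 - c(-1))/2 selects
  the odd characters, and multiplying c a by c(-1) replaces \<open>a\<close> by \<open>-a\<close> in
  the full orthogonality relation.\<close>

lemma Xchars_minus_orthogonality:
  fixes p m d :: nat
  assumes "prime p" "odd p" "m dvd p - 1" "d = (p - 1) div m" "odd d"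
  defines "I \<equiv> \<lambda>a b. if \<not> p dvd a \<and> \<not> p dvd b \<and> [a ^ d = b ^ d] (mod p) then 1 else 0 :: real"
  shows "finite (Xchars_minus p m)" "real (card (Xchars_minus p m)) = real m / 2"
    "(\<Sum>c\<in>Xchars_minus p m. c a * cnj (c b)) = of_real (real m / 2 * (I a b - I ((p - 1) * a) b))"
proof -
  note X = Xchars_orthogonality[OF assms(1-4)]
  have p1: "p > 2" using assms(1,2) by (metis even_numeral le_neq_implies_less prime_ge_2_nat)
  have sub: "Xchars_minus p m \<subseteq> Xchars p m" by (auto simp: Xchars_minus_def)
  show fin: "finite (Xchars_minus p m)" using X(1) sub by (rule rev_finite_subset)
  have sq: "[(p - 1) * (p - 1) = 1] (mod p)"
  proof -
    have eq: "(p - 1) * (p - 1) = 1 + (p - 2) * p" using p1 by (auto simp: algebra_simps le_Suc_ex nat_diff_split elim!: less_natE)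
    show ?thesis unfolding cong_def eq by (rule mod_mult_self1)
  qed
  have sgn: "c (p - 1) = 1 \<or> c (p - 1) = -1" if "c \<in> Xchars p m" for c
  proof -
    have d: "dchar p c" using that by (simp add: Xchars_def)
    then have "c (p - 1) * c (p - 1) = 1" using dchar_cong[OF d sq] by (simp add: dchar_def)
    then show ?thesis using square_eq_1_iff by blast
  qed
  have main: "(\<Sum>c\<in>Xchars_minus p m. c a * cnj (c b)) = of_real (real m / 2 * (I a b - I ((p - 1) * a) b))" for a b
  proof -
    have "(\<Sum>c\<in>Xchars_minus p m. c a * cnj (c b)) =
        (\<Sum>c\<in>Xchars p m. if c (p - 1) = -1 then c a * cnj (c b) else 0)"
      unfolding Xchars_minus_def using X(1) by (simp add: sum.inter_filter)
    also have "\<dots> = (\<Sum>c\<in>Xchars p m. (c a * cnj (c b) - c ((p - 1) * a) * cnj (c b)) / 2)"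
    proof (rule sum.cong)
      fix c assume c: "c \<in> Xchars p m"
      then have "c ((p - 1) * a) = c (p - 1) * c a" by (simp add: Xchars_def dchar_def)
      then show "(if c (p - 1) = -1 then c a * cnj (c b) else 0) =
          (c a * cnj (c b) - c ((p - 1) * a) * cnj (c b)) / 2"
        using sgn[OF c] by auto
    qed simp
    also have "\<dots> = ((\<Sum>c\<in>Xchars p m. c a * cnj (c b)) - (\<Sum>c\<in>Xchars p m. c ((p - 1) * a) * cnj (c b))) / 2"
      by (simp only: sum_subtractf[symmetric] sum_divide_distrib)
    also have "\<dots> = of_real (real m / 2 * (I a b - I ((p - 1) * a) b))"
      unfolding X(3) I_def by simp
    finally show ?thesis .
  qed
  then show "(\<Sum>c\<in>Xchars_minus p m. c a * cnj (c b)) = of_real (real m / 2 * (I a b - I ((p - 1) * a) b))" .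
  \<comment> \<open>Here d odd is used: (-1)^d = -1, so -1 is outside the subgroup and odd
    characters exist.\<close>
  have "\<not> [((p - 1) * 1) ^ d = 1 ^ d] (mod p)"
  proof
    assume *: "[((p - 1) * 1) ^ d = 1 ^ d] (mod p)"
    obtain t where t: "d = 2 * t + 1" using assms(5) oddE by blast
    have "[((p - 1) * (p - 1)) ^ t * (p - 1) = 1 ^ t * (p - 1)] (mod p)"
      by (intro cong_mult cong_pow sq cong_refl)
    then have "[(p - 1) ^ d = p - 1] (mod p)" by (simp add: t power_mult power2_eq_square power_mult_distrib mult_ac)
    with * have "[p - 1 = 1] (mod p)" by (simp add: cong_def)
    then show False using p1 by (simp add: cong_def)
  qed
  then have I1: "I 1 1 = 1" "I ((p - 1) * 1) 1 = 0" using p1 by (auto simp: I_def)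
  \<comment> \<open>The cardinality is the orthogonality relation at a = b = 1.\<close>
  have "complex_of_nat (card (Xchars_minus p m)) = (\<Sum>c\<in>Xchars_minus p m. c 1 * cnj (c 1))"
    by (simp add: Xchars_minus_def Xchars_def dchar_def)
  also have "\<dots> = of_real (real m / 2)" unfolding main I1 by simp
  finally have "complex_of_real (real (card (Xchars_minus p m))) = complex_of_real (real m / 2)" by simp
  then show "real (card (Xchars_minus p m)) = real m / 2" by (simp only: of_real_eq_iff)
qed

subsection \<open>Exceptional primes\<close>

lemma prod_primes_dvd:
  assumes "finite A" "\<And>p. p \<in> A \<Longrightarrow> prime p \<and> p dvd (n::nat)"
  shows "\<Prod>A dvd n"
  using assms
proof (induction A rule: finite_induct)
  case (insert q A)
  have "\<not> q dvd \<Prod>A"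
    using insert by (metis id_apply insertI1 insertI2 primes_dvd_imp_eq prime_dvd_prod_iff prod.cong)
  then have "coprime q (\<Prod>A)" using insert prime_imp_coprime_nat by blast
  then show ?case using insert by (simp add: divides_mult)
qed simp

text \<open>The product of the distinct primes divides n, hence Q^(card A) <= n.\<close>

lemma card_prime_divisors_ge_le:
  fixes Q :: real and n :: nat
  assumes "n > 0" "Q > 1" "finite A" "\<And>p. p \<in> A \<Longrightarrow> prime p \<and> p dvd n \<and> Q \<le> real p"
  shows "real (card A) \<le> ln (real n) / ln Q"
proof -
  have "Q ^ card A \<le> (\<Prod>p\<in>A. real p)"
    using assms prod_mono[of A "\<lambda>_. Q" real] by (simp add: order.trans)
  also have "\<dots> = real (\<Prod>A)" by simp
  also have "\<dots> \<le> real n"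
    using prod_primes_dvd[of A n] assms by (intro of_nat_mono dvd_imp_le) auto
  finally have "ln (Q ^ card A) \<le> ln (real n)" using assms by (subst ln_le_cancel_iff) auto
  then show ?thesis using assms by (simp add: ln_realpow field_simps)
qed

text \<open>For each \<open>a\<close> there are at most R/a values of b; the harmonic sum over a <=
  R supplies the logarithm.\<close>

lemma card_hyperbola_pairs_le:
  fixes R :: real
  assumes "R \<ge> 1"
  shows "finite {(a::nat, b::nat). a > 0 \<and> b > 0 \<and> real a * real b \<le> R}"
    "real (card {(a::nat, b::nat). a > 0 \<and> b > 0 \<and> real a * real b \<le> R}) \<le> R * (1 + ln R)"
proof -
  define P where "P = {(a::nat, b::nat). a > 0 \<and> b > 0 \<and> real a * real b \<le> R}"
  define M where "M = nat \<lfloor>R\<rfloor>"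
  have M: "M > 0" "real M \<le> R" using assms by (auto simp: M_def le_floor_iff)
  have sub: "P \<subseteq> Sigma {1..M} (\<lambda>a. {1..nat \<lfloor>R / real a\<rfloor>})"
  proof clarify
    fix a b assume "(a, b) \<in> P"
    then have ab: "a > 0" "b > 0" "real a * real b \<le> R" by (auto simp: P_def)
    have "real a * 1 \<le> real a * real b" using ab by (intro mult_left_mono) auto
    then have "real a \<le> R" using ab(3) by linarith
    then have "a \<le> M" by (simp add: M_def le_nat_floor)
    moreover have "b \<le> nat \<lfloor>R / real a\<rfloor>"
      using ab by (intro le_nat_floor) (simp add: field_simps)
    ultimately show "a \<in> {1..M} \<and> b \<in> {1..nat \<lfloor>R / real a\<rfloor>}" using ab by auto
  qed
  show "finite {(a::nat, b::nat). a > 0 \<and> b > 0 \<and> real a * real b \<le> R}"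
    using finite_subset[OF sub] unfolding P_def by blast
  have "card P \<le> card (Sigma {1..M} (\<lambda>a. {1..nat \<lfloor>R / real a\<rfloor>}))"
    using sub by (intro card_mono) auto
  also have "\<dots> = (\<Sum>a=1..M. nat \<lfloor>R / real a\<rfloor>)" by simp
  finally have "real (card P) \<le> (\<Sum>a=1..M. real (nat \<lfloor>R / real a\<rfloor>))"
    by (metis of_nat_le_iff of_nat_sum)
  also have "\<dots> \<le> (\<Sum>a=1..M. R * (1 / real a))"
    using assms by (intro sum_mono) (auto intro!: of_nat_floor)
  also have "\<dots> = R * (\<Sum>a=1..M. 1 / real a)" by (simp add: sum_distrib_left)
  also have "\<dots> \<le> R * (1 + ln R)"
  proof (rule mult_left_mono)
    have "ln (real M) \<le> ln R" using M by (subst ln_le_cancel_iff) auto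
    then show "(\<Sum>a=1..M. 1 / real a) \<le> 1 + ln R" using sum_inverse_le_ln[OF M(1)] by linarith
  qed (use assms in auto)
  finally show "real (card {(a::nat, b::nat). a > 0 \<and> b > 0 \<and> real a * real b \<le> R}) \<le> R * (1 + ln R)"
    by (simp add: P_def)
qed

text \<open>The exponent d ranges over all positive integers up to D, with no reference to p - 1:
  one set covers every m, and the triples (d, a, b) can be counted independently of p. The doubled
  exponent also catches a^d = -b^d.\<close>

definition exceptional_primes :: "real \<Rightarrow> real \<Rightarrow> real \<Rightarrow> nat set" where
  "exceptional_primes D Q R = {p. prime p \<and> Q \<le> real p \<and> real p \<le> 2 * Q \<and>
     (\<exists>d a b. 0 < d \<and> real d \<le> D \<and> 0 < a \<and> 0 < b \<and> a \<noteq> b \<and> real a * real b \<le> R \<and>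
        [a ^ (2 * d) = b ^ (2 * d)] (mod p))}"

lemma cong_imp_dvd_abs_diff:
  "[x = y] (mod p) \<Longrightarrow> (p::nat) dvd nat \<bar>int x - int y\<bar>"
  by (simp add: cong_iff_dvd_diff flip: cong_int_iff)

text \<open>A triple (d, a, b) excludes only prime divisors of a nonzero integer of size at most
  R^(2d), that is, at most 2 D ln R / ln Q primes from Q on. There are at most D R (1 + ln R)
  triples.\<close>

lemma card_exceptional_primes_le_ln_Q:
  fixes D Q R :: real
  assumes "D \<ge> 2" "Q \<ge> 2" "R \<ge> 2"
  shows "real (card (exceptional_primes D Q R)) \<le> 6 * D\<^sup>2 * R * (ln R)\<^sup>2 / ln Q"
proof -
  define P where "P = {(a::nat, b::nat). a > 0 \<and> b > 0 \<and> real a * real b \<le> R}"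
  define I where "I = {1..nat \<lfloor>D\<rfloor>} \<times> {(a, b) \<in> P. a \<noteq> b}"
  define E where "E = (\<lambda>(d, (a, b)). {p. prime p \<and> Q \<le> real p \<and> real p \<le> 2 * Q \<and>
                    [a ^ (2 * d) = b ^ (2 * d)] (mod p)})"
  have P: "finite P" "real (card P) \<le> R * (1 + ln R)"
    unfolding P_def using card_hyperbola_pairs_le[of R] assms by auto
  have finQ: "finite {p::nat. real p \<le> 2 * Q}"
    by (rule finite_subset[of _ "{..nat \<lfloor>2 * Q\<rfloor>}"]) (auto simp: le_nat_floor)
  have lnR: "ln R \<ge> 1 / 2" "ln R > 0" and lnQ: "ln Q > 0"
  proof -
    have "ln 2 \<le> ln R" using assms by (subst ln_le_cancel_iff) auto
    then show "ln R \<ge> 1 / 2" using ln2_ge_two_thirds by linarith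
    then show "ln R > 0" by linarith
    show "ln Q > 0" using assms by simp
  qed
  have E: "real (card (E x)) \<le> 2 * D * ln R / ln Q" if "x \<in> I" for x
  proof -
    obtain d a b where x: "x = (d, (a, b))" by (cases x) auto
    have ab: "d > 0" "real d \<le> D" "a > 0" "b > 0" "a \<noteq> b" "real a * real b \<le> R"
      using that assms by (auto simp: x I_def P_def le_nat_iff le_floor_iff)
    define n where "n = nat \<bar>int (a ^ (2 * d)) - int (b ^ (2 * d))\<bar>"
    have "a ^ (2 * d) \<noteq> b ^ (2 * d)"
      using ab power_eq_imp_eq_base[of a "2 * d" b] by auto
    then have n0: "n > 0" unfolding n_def by linarith
    have "real a * 1 \<le> real a * real b" "1 * real b \<le> real a * real b"
      using ab by (intro mult_left_mono mult_right_mono; simp)+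
    then have aR: "real a \<le> R" "real b \<le> R" using ab(6) by linarith+
    then have "real (a ^ (2 * d)) \<le> R ^ (2 * d)" "real (b ^ (2 * d)) \<le> R ^ (2 * d)"
      by (simp_all add: power_mono)
    moreover have "n \<le> max (a ^ (2 * d)) (b ^ (2 * d))" unfolding n_def by linarith
    ultimately have "real n \<le> R ^ (2 * d)" by (smt (verit) max_def of_nat_mono)
    then have "ln (real n) \<le> ln (R ^ (2 * d))" using n0 assms by (subst ln_le_cancel_iff) auto
    also have "\<dots> = 2 * real d * ln R" using assms by (simp add: ln_realpow)
    also have "\<dots> \<le> 2 * D * ln R" using ab lnR by (intro mult_right_mono) auto
    finally have ln: "ln (real n) \<le> 2 * D * ln R" .
    have "real (card (E x)) \<le> ln (real n) / ln Q"
    proof (rule card_prime_divisors_ge_le)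
      show "finite (E x)" by (rule finite_subset[OF _ finQ]) (auto simp: E_def x)
      show "prime p \<and> p dvd n \<and> Q \<le> real p" if "p \<in> E x" for p
        using that cong_imp_dvd_abs_diff[of "a ^ (2 * d)" "b ^ (2 * d)" p] by (simp add: E_def x n_def)
    qed (use n0 assms in auto)
    also have "\<dots> \<le> 2 * D * ln R / ln Q" using ln lnQ by (intro divide_right_mono) auto
    finally show ?thesis .
  qed
  have finI: "finite I"
    unfolding I_def using P(1) by (intro finite_cartesian_product) (auto intro: rev_finite_subset)
  have "exceptional_primes D Q R \<subseteq> (\<Union>x\<in>I. E x)"
  proof
    fix p assume "p \<in> exceptional_primes D Q R"
    then obtain d a b where *: "0 < d" "real d \<le> D" "0 < a" "0 < b" "a \<noteq> b" "real a * real b \<le> R"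
      "[a ^ (2 * d) = b ^ (2 * d)] (mod p)" "prime p" "Q \<le> real p" "real p \<le> 2 * Q"
      by (auto simp: exceptional_primes_def)
    have "d \<le> nat \<lfloor>D\<rfloor>" using *(2) by (simp add: le_nat_floor)
    then have "(d, (a, b)) \<in> I" using * by (auto simp: I_def P_def)
    moreover have "p \<in> E (d, (a, b))" using * by (simp add: E_def)
    ultimately show "p \<in> (\<Union>x\<in>I. E x)" by blast
  qed
  then have "card (exceptional_primes D Q R) \<le> card (\<Union>x\<in>I. E x)"
    by (rule card_mono[rotated])
       (auto intro!: finite_UN_I[OF finI] intro: finite_subset[OF _ finQ] simp: E_def)
  also have "\<dots> \<le> (\<Sum>x\<in>I. card (E x))" by (rule card_UN_le[OF finI])
  finally have "real (card (exceptional_primes D Q R)) \<le> (\<Sum>x\<in>I. real (card (E x)))"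
    by (metis of_nat_le_iff of_nat_sum)
  also have "\<dots> \<le> real (card I) * (2 * D * ln R / ln Q)"
    using E by (rule sum_bounded_above)
  also have "\<dots> \<le> (D * (3 * R * ln R)) * (2 * D * ln R / ln Q)"
  proof (rule mult_right_mono)
    have "card I \<le> nat \<lfloor>D\<rfloor> * card P"
      unfolding I_def using P(1) by (auto simp: card_cartesian_product intro!: mult_le_mono2 card_mono)
    then have "real (card I) \<le> real (nat \<lfloor>D\<rfloor>) * real (card P)" by (metis of_nat_le_iff of_nat_mult)
    also have "\<dots> \<le> D * (R * (1 + ln R))"
      using P assms by (intro mult_mono) auto
    \<comment> \<open>From ln R >= 1/2 one has 1 <= 2 ln R; together with the 2 from R^(2d) this
      gives the constant 6.\<close>
    also have "\<dots> \<le> D * (R * (3 * ln R))"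
      using assms lnR by (intro mult_left_mono) auto
    finally show "real (card I) \<le> D * (3 * R * ln R)" by simp
  qed (use assms lnR lnQ in auto)
  also have "\<dots> = 6 * D\<^sup>2 * R * (ln R)\<^sup>2 / ln Q" by (simp add: power2_eq_square)
  finally show ?thesis .
qed

text \<open>To replace ln Q by ln D: if D <= 2Q then ln D <= 2 ln Q, which doubles the constant.
  Otherwise there are at most 2Q < D integers to exclude, and the asserted bound already exceeds
  D.\<close>

lemma card_exceptional_primes_le:
  fixes D Q R :: real
  assumes "D \<ge> 2" "Q \<ge> 2" "R \<ge> 2"
  shows "real (card (exceptional_primes D Q R)) \<le> 12 * D\<^sup>2 * R * (ln R)\<^sup>2 / ln D"
proof (cases "D \<le> 2 * Q")
  case True
  have lnQ: "ln Q > 0" and lnD: "ln D > 0" using assms by auto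
  have "ln 2 \<le> ln Q" using assms by (subst ln_le_cancel_iff) auto
  moreover have "ln D \<le> ln (2 * Q)" using True assms by (subst ln_le_cancel_iff) auto
  moreover have "ln (2 * Q) = ln 2 + ln Q" using assms by (simp add: ln_mult)
  ultimately have "ln D \<le> 2 * ln Q" by linarith
  then have "6 * D\<^sup>2 * R * (ln R)\<^sup>2 / ln Q \<le> 6 * D\<^sup>2 * R * (ln R)\<^sup>2 / (ln D / 2)"
    using assms lnD lnQ by (intro divide_left_mono) auto
  then show ?thesis using card_exceptional_primes_le_ln_Q[OF assms] by simp
next
  case False
  have lnD: "ln D > 0" using assms by auto
  have "exceptional_primes D Q R \<subseteq> {1..nat \<lfloor>2 * Q\<rfloor>}"
    by (auto simp: exceptional_primes_def le_nat_floor Suc_le_eq prime_gt_0_nat)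
  then have "card (exceptional_primes D Q R) \<le> nat \<lfloor>2 * Q\<rfloor>"
    by (metis card_atLeastAtMost card_mono diff_Suc_1 finite_atLeastAtMost One_nat_def)
  then have "real (card (exceptional_primes D Q R)) \<le> real (nat \<lfloor>2 * Q\<rfloor>)" by (rule of_nat_mono)
  also have "\<dots> \<le> 2 * Q" using assms by (intro of_nat_floor) auto
  also have "\<dots> \<le> D * 1" using False by simp
  \<comment> \<open>The last factor is R (ln R)^2 at the lower bounds R >= 2 and ln R >= 1/2,
    inserted so that the next step is monotonicity.\<close>
  also have "\<dots> \<le> D * (12 * (D / ln D) * (2 * (1 / 2)\<^sup>2))"
  proof (rule mult_left_mono)
    have "ln D \<le> D" using assms ln_le_minus_one[of D] by simp
    then show "1 \<le> 12 * (D / ln D) * (2 * (1 / 2)\<^sup>2)" using lnD by (simp add: field_simps power2_eq_square)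
  qed (use assms in auto)
  also have "\<dots> \<le> D * (12 * (D / ln D) * (R * (ln R)\<^sup>2))"
  proof (intro mult_left_mono mult_mono power_mono)
    have "ln 2 \<le> ln R" using assms by (subst ln_le_cancel_iff) auto
    then show "1 / 2 \<le> ln R" using ln2_ge_two_thirds by linarith
  qed (use assms lnD in auto)
  also have "\<dots> = 12 * D\<^sup>2 * R * (ln R)\<^sup>2 / ln D" by (simp add: power2_eq_square)
  finally show ?thesis .
qed

subsection \<open>Evaluation of the correlation sums\<close>

text \<open>Off the diagonal the kernel is at most 1 in modulus and vanishes unless the 2d-th powers
  agree, so the count over 2d lattices applies with weights w a <= C a^(-\<theta>).\<close>

lemma correlation_sum_off_diagonal_le:
  fixes \<theta> \<kappa> C R :: real and p d k N :: nat
  assumes "prime p" "d > 0" "R > 0" "0 \<le> \<kappa>" "\<kappa> < \<theta>" "3 / 4 \<le> \<theta>" "\<theta> < 1" "N > 0"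
    and tau: "\<And>n. n > 0 \<Longrightarrow> real (tau k n) \<le> C * real n powr (1 - \<theta>)" and C: "C \<ge> 1"
    and R: "\<And>a b. a > 0 \<Longrightarrow> b > 0 \<Longrightarrow> a \<noteq> b \<Longrightarrow> [a ^ (2 * d) = b ^ (2 * d)] (mod p) \<Longrightarrow> R < real a * real b"
    and \<delta>0: "\<And>a b. p dvd a \<or> p dvd b \<Longrightarrow> \<delta> a b = 0"
    and \<delta>1: "\<And>a b. a \<noteq> b \<Longrightarrow> \<bar>\<delta> a b\<bar> \<le> 1"
    and \<delta>2: "\<And>a b. a \<noteq> b \<Longrightarrow> \<not> [a ^ (2 * d) = b ^ (2 * d)] (mod p) \<Longrightarrow> \<delta> a b = (0::real)"
  defines "w \<equiv> \<lambda>a. real (bounded_tau N k a) / real a"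
  shows "\<bar>(\<Sum>a=1..N ^ k. \<Sum>b=1..N ^ k. w a * w b * \<delta> a b) - (\<Sum>a=1..N ^ k. (w a)\<^sup>2 * \<delta> a a)\<bar> \<le>
    C\<^sup>2 * (real (2 * d) * ((\<Sum>n. real (Suc n) powr (- (3 / 2))) *
          (4 powr \<kappa> * (1 / (1 - 2 powr (\<kappa> - \<theta>)))\<^sup>2 * R powr (-\<kappa>) +
           6 * (2 powr (1 - \<theta>) / (2 powr (1 - \<theta>) - 1))\<^sup>2 * real (N ^ k) powr (2 * (1 - \<theta>)) / real p)))"
    (is "_ \<le> C\<^sup>2 * ?B")
proof -
  define H where "H = N ^ k"
  define S where "S = {(a, b). a \<in> {1..H} \<and> b \<in> {1..H} \<and> \<not> p dvd a \<and> \<not> p dvd b \<and> a \<noteq> b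
                   \<and> [a ^ (2 * d) = b ^ (2 * d)] (mod p)}"
  define Off where "Off = {(a, b). a \<in> {1..H} \<and> b \<in> {1..H} \<and> a \<noteq> b}"
  define T where "T = (\<lambda>(a, b). w a * w b * \<delta> a b)"
  have w0: "w a \<ge> 0" for a by (simp add: w_def)
  have wle: "w a \<le> C * real a powr (- \<theta>)" if "a > 0" for a
  proof -
    have "w a \<le> (C * real a powr (1 - \<theta>)) / real a"
      unfolding w_def using bounded_tau_le_tau[OF that, of N k] tau[OF that]
      by (intro divide_right_mono) linarith+
    also have "\<dots> = C * real a powr (- \<theta>)"
      using that by (simp add: powr_diff powr_minus field_simps)
    finally show ?thesis .
  qed
  have finOff: "finite Off" and finS: "finite S"
    by (rule finite_subset[of _ "{1..H} \<times> {1..H}"]; auto simp: Off_def S_def)+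
  have split: "{1..H} \<times> {1..H} = Off \<union> (\<lambda>a. (a, a)) ` {1..H}" "Off \<inter> (\<lambda>a. (a, a)) ` {1..H} = {}"
    by (auto simp: Off_def)
  have "(\<Sum>a=1..H. \<Sum>b=1..H. w a * w b * \<delta> a b) = (\<Sum>x\<in>{1..H} \<times> {1..H}. T x)"
    by (simp add: sum.cartesian_product T_def)
  also have "\<dots> = (\<Sum>x\<in>Off. T x) + (\<Sum>x\<in>(\<lambda>a. (a, a)) ` {1..H}. T x)"
    unfolding split(1) using finOff split(2) by (intro sum.union_disjoint) auto
  also have "(\<Sum>x\<in>(\<lambda>a. (a, a)) ` {1..H}. T x) = (\<Sum>a=1..H. (w a)\<^sup>2 * \<delta> a a)"
    by (subst sum.reindex) (auto simp: inj_on_def T_def power2_eq_square)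
  finally have "\<bar>(\<Sum>a=1..H. \<Sum>b=1..H. w a * w b * \<delta> a b) - (\<Sum>a=1..H. (w a)\<^sup>2 * \<delta> a a)\<bar> = \<bar>\<Sum>x\<in>Off. T x\<bar>"
    by simp
  also have "(\<Sum>x\<in>Off. T x) = (\<Sum>x\<in>S. T x)"
  proof (intro sum.mono_neutral_right ballI)
    fix x assume x: "x \<in> Off - S"
    obtain a b where ab: "x = (a, b)" by (cases x)
    then have "\<delta> a b = 0" using x \<delta>0[of a b] \<delta>2[of a b] by (auto simp: Off_def S_def)
    then show "T x = 0" by (simp add: ab T_def)
  qed (use finOff in \<open>auto simp: Off_def S_def\<close>)
  also have "\<bar>\<Sum>x\<in>S. T x\<bar> \<le> (\<Sum>x\<in>S. \<bar>T x\<bar>)" by (rule sum_abs)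
  also have "\<dots> \<le> (\<Sum>x\<in>S. C\<^sup>2 * (case x of (a, b) \<Rightarrow> (real a * real b) powr (- \<theta>)))"
  proof (rule sum_mono)
    fix x assume "x \<in> S"
    then obtain a b where x: "x = (a, b)" "a > 0" "b > 0" "a \<noteq> b" by (auto simp: S_def)
    have "\<bar>T x\<bar> = (w a * w b) * \<bar>\<delta> a b\<bar>" using w0 by (simp add: x T_def abs_mult)
    also have "\<dots> \<le> (w a * w b) * 1" using w0 \<delta>1[OF x(4)] by (intro mult_left_mono) auto
    also have "\<dots> \<le> (C * real a powr (- \<theta>)) * (C * real b powr (- \<theta>))"
      using wle[OF x(2)] wle[OF x(3)] w0 C by (simp add: mult_mono)
    also have "\<dots> = C\<^sup>2 * (real a * real b) powr (- \<theta>)"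
      by (simp add: powr_mult power2_eq_square)
    finally show "\<bar>T x\<bar> \<le> C\<^sup>2 * (case x of (a, b) \<Rightarrow> (real a * real b) powr (- \<theta>))" by (simp add: x)
  qed
  also have "\<dots> = C\<^sup>2 * (\<Sum>(a, b)\<in>S. (real a * real b) powr (- \<theta>))" by (simp add: sum_distrib_left)
  also have "\<dots> \<le> C\<^sup>2 * ?B"
  proof (rule mult_left_mono)
    show "(\<Sum>(a, b)\<in>S. (real a * real b) powr (- \<theta>)) \<le> ?B"
      unfolding S_def H_def
      by (rule sum_power_congruent_points_le) (use assms R in auto)
  qed simp
  finally show ?thesis by (simp add: H_def)
qed

text \<open>The diagonal lies between the series for \<open>a_const k\<close> and its first p - 1
  terms: for a < p <= N the coefficient is exactly \<open>tau k a\<close> and p does not divide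
  \<open>a\<close>. Only the tail of the series has to be estimated.\<close>

lemma correlation_sum_diagonal_close:
  fixes \<theta> C :: real and p k N :: nat
  assumes "prime p" "7 / 8 \<le> \<theta>" "p \<le> N" "k \<ge> 1"
    and tau: "\<And>n. n > 0 \<Longrightarrow> real (tau k n) \<le> C * real n powr (1 - \<theta>)"
    and \<delta>0: "\<And>a. p dvd a \<Longrightarrow> \<delta> a a = 0"
    and \<delta>1: "\<And>a. \<not> p dvd a \<Longrightarrow> \<delta> a a = (1::real)"
  defines "w \<equiv> \<lambda>a. real (bounded_tau N k a) / real a"
  shows "\<bar>(\<Sum>a=1..N ^ k. (w a)\<^sup>2 * \<delta> a a) - a_const k\<bar> \<le>
    C\<^sup>2 * (\<Sum>n. real (Suc n) powr (- (5 / 4))) * real p powr (- (1 / 2))"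
proof -
  define t where "t n = real (tau k (Suc n)) ^ 2 / real (Suc n) ^ 2" for n
  have p1: "p > 1" using assms(1) prime_gt_1_nat by blast
  have t0: "t n \<ge> 0" for n by (simp add: t_def)
  have tle: "t n \<le> C\<^sup>2 * real (Suc n) powr (- (7 / 4))" for n
  proof -
    have "t n = (real (tau k (Suc n)) / real (Suc n))\<^sup>2" by (simp add: t_def power_divide)
    also have "\<dots> \<le> (C * real (Suc n) powr (1 - \<theta>) / real (Suc n))\<^sup>2"
      using tau[of "Suc n"] by (intro power_mono divide_right_mono) auto
    also have "C * real (Suc n) powr (1 - \<theta>) / real (Suc n) = C * real (Suc n) powr (- \<theta>)"
      using powr_diff[of "real (Suc n)" "1 - \<theta>" 1] by simp
    also have "(C * real (Suc n) powr (- \<theta>))\<^sup>2 = C\<^sup>2 * real (Suc n) powr (- (2 * \<theta>))"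
      by (simp add: power_mult_distrib powr_power)
    also have "\<dots> \<le> C\<^sup>2 * real (Suc n) powr (- (7 / 4))"
      using assms(2) by (intro mult_left_mono powr_mono) auto
    finally show ?thesis .
  qed
  have summ: "summable (\<lambda>n. real (Suc n) powr s)" if "s < -1" for s
    using summable_real_powr_iff[of s] that
    by (subst summable_Suc_iff[of "\<lambda>n. real n powr s"]) simp
  have st: "summable t"
    by (rule summable_comparison_test'[of "\<lambda>n. C\<^sup>2 * real (Suc n) powr (- (7 / 4))" 0])
       (use tle t0 summ[of "- (7 / 4)"] in \<open>auto intro: summable_mult\<close>)
  have a: "a_const k = suminf t" by (simp add: a_const_def t_def[abs_def])
  have idx: "(\<Sum>a=1..M. (real (tau k a) / real a)\<^sup>2) = (\<Sum>n<M. t n)" for M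
    by (rule sum.reindex_bij_witness[of _ Suc "\<lambda>n. n - 1"]) (auto simp: t_def power_divide)
  define Dg where "Dg = (\<Sum>a=1..N ^ k. (w a)\<^sup>2 * \<delta> a a)"
  have "Dg \<le> (\<Sum>a=1..N ^ k. (real (tau k a) / real a)\<^sup>2)"
    unfolding Dg_def
  proof (rule sum_mono)
    fix a assume "a \<in> {1..N ^ k}"
    then have "a > 0" by simp
    have "(w a)\<^sup>2 * \<delta> a a \<le> (w a)\<^sup>2" using \<delta>0[of a] \<delta>1[of a] by (cases "p dvd a") auto
    also have "\<dots> \<le> (real (tau k a) / real a)\<^sup>2"
      unfolding w_def using bounded_tau_le_tau[OF \<open>a > 0\<close>, of N k]
      by (intro power_mono divide_right_mono) auto
    finally show "(w a)\<^sup>2 * \<delta> a a \<le> (real (tau k a) / real a)\<^sup>2" .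
  qed
  also have "\<dots> \<le> suminf t" unfolding idx by (rule sum_le_suminf[OF st]) (use t0 in auto)
  finally have upper: "Dg \<le> a_const k" by (simp add: a)
  have "N ^ 1 \<le> N ^ k" using assms(3,4) p1 by (intro power_increasing) auto
  then have NH: "N \<le> N ^ k" by simp
  have "(\<Sum>n<p - 1. t n) = (\<Sum>a=1..p - 1. (real (tau k a) / real a)\<^sup>2)" by (rule idx[symmetric])
  also have "\<dots> = (\<Sum>a=1..p - 1. (w a)\<^sup>2 * \<delta> a a)"
  proof (rule sum.cong)
    fix a assume "a \<in> {1..p - 1}"
    then have "a > 0" "a < p" "a \<le> N" using assms(3) by auto
    then have "\<not> p dvd a" using nat_dvd_not_less by blast
    then show "(real (tau k a) / real a)\<^sup>2 = (w a)\<^sup>2 * \<delta> a a"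
      using \<delta>1 bounded_tau_eq_tau[OF \<open>a > 0\<close> \<open>a \<le> N\<close>] by (simp add: w_def)
  qed simp
  also have "\<dots> \<le> Dg"
    unfolding Dg_def
  proof (rule sum_mono2)
    show "{1..p - 1} \<subseteq> {1..N ^ k}" using NH assms(3) by auto
    show "0 \<le> (w b)\<^sup>2 * \<delta> b b" for b using \<delta>0[of b] \<delta>1[of b] by (cases "p dvd b") auto
  qed simp
  finally have lower: "(\<Sum>n<p - 1. t n) \<le> Dg" .
  have "a_const k - Dg \<le> (\<Sum>n. t (n + (p - 1)))"
    using suminf_split_initial_segment[OF st, of "p - 1"] lower by (simp add: a)
  also have "\<dots> \<le> (\<Sum>n. C\<^sup>2 * real p powr (- (1 / 2)) * real (Suc n) powr (- (5 / 4)))"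
  proof (rule suminf_le)
    fix n
    \<comment> \<open>\<open>t\<close> is indexed from 0, so the tail starts at the integer p. The
      exponent 7/4 = 2 * 7/8 is then split into 1/2, which gives the saving, and 5/4, which keeps
      the sum convergent.\<close>
    have e: "Suc (n + (p - 1)) = n + p" using p1 by simp
    have "t (n + (p - 1)) \<le> C\<^sup>2 * real (n + p) powr (- (7 / 4))" using tle[of "n + (p - 1)"] e by simp
    also have "real (n + p) powr (- (7 / 4)) = real (n + p) powr (- (1 / 2)) * real (n + p) powr (- (5 / 4))"
      by (simp flip: powr_add)
    also have "\<dots> \<le> real p powr (- (1 / 2)) * real (Suc n) powr (- (5 / 4))"
      using p1 by (intro mult_mono powr_mono2') auto
    finally show "t (n + (p - 1)) \<le> C\<^sup>2 * real p powr (- (1 / 2)) * real (Suc n) powr (- (5 / 4))"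
      by (simp add: mult.assoc mult_left_mono)
  qed (use st summ[of "- (5 / 4)"] in \<open>auto intro: summable_mult summable_ignore_initial_segment\<close>)
  also have "\<dots> = C\<^sup>2 * (\<Sum>n. real (Suc n) powr (- (5 / 4))) * real p powr (- (1 / 2))"
    using summ[of "- (5 / 4)"] by (subst suminf_mult) (auto simp: mult_ac)
  finally show ?thesis using upper unfolding Dg_def[symmetric] by simp
qed

lemma correlation_sum_close:
  fixes k :: nat and \<kappa> :: real
  assumes "k \<ge> 1" "0 \<le> \<kappa>" "\<kappa> < 1"
  shows "\<exists>K>0. \<forall>(p::nat) (d::nat) (R::real) \<delta>. prime p \<longrightarrow> d > 0 \<longrightarrow> R > 0 \<longrightarrow>
    (\<forall>a b. a > 0 \<longrightarrow> b > 0 \<longrightarrow> a \<noteq> b \<longrightarrow> [a ^ (2 * d) = b ^ (2 * d)] (mod p) \<longrightarrow> R < real a * real b) \<longrightarrow>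
    (\<forall>a. \<not> p dvd a \<longrightarrow> \<delta> a a = 1) \<longrightarrow>
    (\<forall>a b. p dvd a \<or> p dvd b \<longrightarrow> \<delta> a b = 0) \<longrightarrow>
    (\<forall>a b. a \<noteq> b \<longrightarrow> \<bar>\<delta> a b\<bar> \<le> 1) \<longrightarrow>
    (\<forall>a b. a \<noteq> b \<longrightarrow> \<not> [a ^ (2 * d) = b ^ (2 * d)] (mod p) \<longrightarrow> \<delta> a b = 0) \<longrightarrow>
    \<bar>(\<Sum>a=1..(p\<^sup>2) ^ k. \<Sum>b=1..(p\<^sup>2) ^ k.
        (real (bounded_tau (p\<^sup>2) k a) / real a) * (real (bounded_tau (p\<^sup>2) k b) / real b) * \<delta> a b) - a_const k\<bar>
      \<le> K * real d * (R powr (-\<kappa>) + real p powr (-1/2))"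
proof -
  \<comment> \<open>The first entry gives p^(4 k \<epsilon>) / p <= p^(-1/2) and \<theta> >= 7/8,
    the second \<kappa> < \<theta>.\<close>
  define \<epsilon> where "\<epsilon> = min (1 / (8 * real k)) ((1 - \<kappa>) / 2)"
  define \<theta> where "\<theta> = 1 - \<epsilon>"
  have \<epsilon>: "\<epsilon> > 0" using assms by (simp add: \<epsilon>_def)
  have \<epsilon>': "\<epsilon> \<le> 1 / (8 * real k)" "\<epsilon> \<le> (1 - \<kappa>) / 2"
    unfolding \<epsilon>_def by (rule min.cobounded1, rule min.cobounded2)
  have "1 / (8 * real k) \<le> 1 / 8" using assms by (simp add: field_simps)
  then have "\<epsilon> \<le> 1 / 8" using \<epsilon>'(1) by linarith
  then have \<theta>: "7 / 8 \<le> \<theta>" "\<theta> < 1" "\<kappa> < \<theta>"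
    using \<epsilon> \<epsilon>'(2) assms(3) by (auto simp: \<theta>_def field_simps)
  obtain C where C: "C \<ge> 1" "\<And>n. n > 0 \<Longrightarrow> real (tau k n) \<le> C * real n powr (1 - \<theta>)"
    using tau_le_powr[OF \<epsilon> assms(1)] by (auto simp: \<theta>_def)
  define Z where "Z = (\<Sum>n. real (Suc n) powr (- (3 / 2)))"
  define Z' where "Z' = (\<Sum>n. real (Suc n) powr (- (5 / 4)))"
  define c1 where "c1 = 4 powr \<kappa> * (1 / (1 - 2 powr (\<kappa> - \<theta>)))\<^sup>2"
  define c2 where "c2 = 6 * (2 powr (1 - \<theta>) / (2 powr (1 - \<theta>) - 1))\<^sup>2"
  have summ: "summable (\<lambda>n. real (Suc n) powr s)" if "s < -1" for s
    using summable_real_powr_iff[of s] that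
    by (subst summable_Suc_iff[of "\<lambda>n. real n powr s"]) simp
  have Z: "Z \<ge> 0" "Z' \<ge> 0"
    unfolding Z_def Z'_def by (intro suminf_nonneg summ; simp)+
  have c: "c1 \<ge> 0" "c2 \<ge> 0" by (auto simp: c1_def c2_def)
  \<comment> \<open>2Z(c1 + c2) comes from the 2d lattices, Z' from the diagonal; the 1 makes K
    positive.\<close>
  define K where "K = C\<^sup>2 * (2 * Z * (c1 + c2) + Z') + 1"
  have K: "K > 0" using Z c by (auto simp: K_def intro!: add_nonneg_pos)
  have "\<bar>(\<Sum>a=1..(p\<^sup>2) ^ k. \<Sum>b=1..(p\<^sup>2) ^ k.
        (real (bounded_tau (p\<^sup>2) k a) / real a) * (real (bounded_tau (p\<^sup>2) k b) / real b) * \<delta> a b) - a_const k\<bar>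
      \<le> K * real d * (R powr (-\<kappa>) + real p powr (-1/2))"
    if p: "prime p" and d: "d > 0" and R: "R > 0"
      and *: "\<And>a b. a > 0 \<Longrightarrow> b > 0 \<Longrightarrow> a \<noteq> b \<Longrightarrow> [a ^ (2 * d) = b ^ (2 * d)] (mod p) \<Longrightarrow> R < real a * real b"
        "\<And>a. \<not> p dvd a \<Longrightarrow> \<delta> a a = 1" "\<And>a b. p dvd a \<or> p dvd b \<Longrightarrow> \<delta> a b = 0"
        "\<And>a b. a \<noteq> b \<Longrightarrow> \<bar>\<delta> a b\<bar> \<le> 1"
        "\<And>a b. a \<noteq> b \<Longrightarrow> \<not> [a ^ (2 * d) = b ^ (2 * d)] (mod p) \<Longrightarrow> \<delta> a b = 0"
    for p d :: nat and R :: real and \<delta> :: "nat \<Rightarrow> nat \<Rightarrow> real"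
  proof -
    define N where "N = p\<^sup>2"
    define w where "w a = real (bounded_tau N k a) / real a" for a
    define r where "r = R powr (-\<kappa>)"
    define q where "q = real p powr (-1/2)"
    have p1: "p > 1" using p prime_gt_1_nat by blast
    have N: "N > 0" "p \<le> N" using p1 by (auto simp: N_def power2_eq_square)
    have rq: "r \<ge> 0" "q \<ge> 0" by (auto simp: r_def q_def)
    have "\<bar>(\<Sum>a=1..N ^ k. \<Sum>b=1..N ^ k. w a * w b * \<delta> a b) - (\<Sum>a=1..N ^ k. (w a)\<^sup>2 * \<delta> a a)\<bar> \<le>
      C\<^sup>2 * (real (2 * d) * (Z * (c1 * r + c2 * real (N ^ k) powr (2 * (1 - \<theta>)) / real p)))"
      unfolding w_def Z_def c1_def c2_def r_def
      by (rule correlation_sum_off_diagonal_le) (use p d R assms \<theta> N C * in auto)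
    also have "\<dots> \<le> C\<^sup>2 * (real (2 * d) * (Z * (c1 * r + c2 * q)))"
    proof -
      have "real (N ^ k) = real p powr (2 * real k)"
        using p1 powr_realpow[of "real p" "2 * k"] by (simp add: N_def power_mult)
      moreover define x where "x = 2 * real k * (2 * (1 - \<theta>))"
      ultimately have "real (N ^ k) powr (2 * (1 - \<theta>)) = real p powr x" by (simp only: powr_powr x_def)
      then have "real (N ^ k) powr (2 * (1 - \<theta>)) / real p = real p powr (x - 1)"
        using p1 by (simp add: powr_diff)
      also have "\<dots> \<le> q"
        unfolding q_def x_def
      proof (rule powr_mono)
        have "\<epsilon> * (8 * real k) \<le> 1" using \<epsilon>'(1) assms(1) by (simp add: field_simps)
        then show "2 * real k * (2 * (1 - \<theta>)) - 1 \<le> -1 / 2" by (simp add: \<theta>_def mult_ac)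
      qed (use p1 in auto)
      finally have "c2 * (real (N ^ k) powr (2 * (1 - \<theta>)) / real p) \<le> c2 * q"
        using c by (intro mult_left_mono) auto
      then show ?thesis using Z c C by (intro mult_left_mono add_left_mono) auto
    qed
    finally have 1: "\<bar>(\<Sum>a=1..N ^ k. \<Sum>b=1..N ^ k. w a * w b * \<delta> a b) - (\<Sum>a=1..N ^ k. (w a)\<^sup>2 * \<delta> a a)\<bar>
        \<le> C\<^sup>2 * (real (2 * d) * (Z * (c1 * r + c2 * q)))" .
    have "\<bar>(\<Sum>a=1..N ^ k. (w a)\<^sup>2 * \<delta> a a) - a_const k\<bar> \<le> C\<^sup>2 * Z' * real p powr (- (1 / 2))"
      unfolding w_def Z'_def
      by (rule correlation_sum_diagonal_close) (use p assms \<theta> N C * in auto)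
    then have 2: "\<bar>(\<Sum>a=1..N ^ k. (w a)\<^sup>2 * \<delta> a a) - a_const k\<bar> \<le> C\<^sup>2 * Z' * q"
      by (simp add: q_def)
    have "C\<^sup>2 * Z' * q \<le> C\<^sup>2 * Z' * (real d * (r + q))"
    proof (rule mult_left_mono)
      have "1 * q \<le> real d * (r + q)" using d rq by (intro mult_mono) auto
      then show "q \<le> real d * (r + q)" by simp
    qed (use Z in auto)
    moreover have "C\<^sup>2 * (real (2 * d) * (Z * (c1 * r + c2 * q))) \<le> C\<^sup>2 * (2 * Z * (c1 + c2)) * (real d * (r + q))"
    proof -
      have "c1 * r + c2 * q \<le> (c1 + c2) * (r + q)" using c rq by (simp add: algebra_simps)
      then have "C\<^sup>2 * (real (2 * d) * (Z * (c1 * r + c2 * q))) \<le> C\<^sup>2 * (real (2 * d) * (Z * ((c1 + c2) * (r + q))))"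
        using Z by (intro mult_left_mono) auto
      then show ?thesis by (simp add: algebra_simps)
    qed
    moreover have "0 \<le> real d * (r + q)" using rq by simp
    ultimately have "\<bar>(\<Sum>a=1..N ^ k. \<Sum>b=1..N ^ k. w a * w b * \<delta> a b) - a_const k\<bar> \<le> K * (real d * (r + q))"
      using 1 2 unfolding K_def by (simp add: algebra_simps)
    then show ?thesis by (simp add: N_def w_def r_def q_def mult.assoc)
  qed
  then show ?thesis using K by blast
qed

subsection \<open>The moments outside the exceptional set\<close>

text \<open>Absorbs the logarithms of the truncation error, so that the final exponent is exactly
  -1/2. It is ln x <= x^a / a with a = 1/(2j), raised to the j-th power.\<close>

lemma affine_ln_power_le_sqrt:
  fixes j :: nat
  assumes "j \<ge> 1"
  shows "\<exists>C>0. \<forall>x\<ge>1. (3 + 2 * ln x) ^ j \<le> C * x powr (1 / 2 :: real)"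
proof -
  define a where "a = 1 / (2 * real j)"
  have a: "a > 0" using assms by (simp add: a_def)
  have "(3 + 2 * ln x) ^ j \<le> (3 + 2 / a) ^ j * x powr (1 / 2)" if "x \<ge> 1" for x
  proof -
    have "ln x \<le> x powr a / a" using that a by (rule ln_powr_bound)
    moreover have "1 \<le> x powr a" using that a by (simp add: ge_one_powr_ge_zero)
    ultimately have "3 + 2 * ln x \<le> (3 + 2 / a) * x powr a" by (simp add: algebra_simps)
    then have "(3 + 2 * ln x) ^ j \<le> ((3 + 2 / a) * x powr a) ^ j"
      using that by (intro power_mono) auto
    also have "\<dots> = (3 + 2 / a) ^ j * x powr (1 / 2)"
      using that assms by (simp add: power_mult_distrib powr_power a_def)
    finally show ?thesis .
  qed
  moreover have "(3 + 2 / a) ^ j > 0" using a by (intro zero_less_power add_pos_pos) auto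
  ultimately show ?thesis by blast
qed

text \<open>The moment omits the principal character while orthogonality includes it. Its truncated
  sum is only logarithmic, and the normalisation 1/m <= 2d/p makes it as small as the truncation
  error; hence the 2 in 4k + 2.\<close>

lemma Mnu_close:
  assumes "prime p" "odd p" "m dvd p - 1" "d = (p - 1) div m" "k \<ge> 1"
  defines "I \<equiv> \<lambda>a b. if \<not> p dvd a \<and> \<not> p dvd b \<and> [a ^ d = b ^ d] (mod p) then 1 else 0 :: real"
  shows "\<bar>Mnu (2 * real k) p m - (\<Sum>a=1..(p\<^sup>2) ^ k. \<Sum>b=1..(p\<^sup>2) ^ k.
      (real (bounded_tau (p\<^sup>2) k a) / real a) * (real (bounded_tau (p\<^sup>2) k b) / real b) * I a b)\<bar>
    \<le> (4 * real k + 2) * real d * (3 + 2 * ln (real p)) ^ (2 * k) / real p"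
proof -
  note X = Xchars_orthogonality[OF assms(1-4)]
  define N where "N = p\<^sup>2"
  define S where "S c = norm (\<Sum>n=1..N. c n / of_nat n) ^ (2 * k)" for c :: "nat \<Rightarrow> complex"
  define L where "L c = norm (L1 c) powr (2 * real k)" for c
  define B where "B = 3 + 2 * ln (real p)"
  define NP where "NP = {c \<in> Xchars p m. \<not> principal_char p c}"
  define PR where "PR = {c \<in> Xchars p m. principal_char p c}"
  define W where "W = (\<Sum>a=1..N ^ k. \<Sum>b=1..N ^ k.
      (real (bounded_tau N k a) / real a) * (real (bounded_tau N k b) / real b) * I a b)"
  have p2: "p \<ge> 2" using assms(1) prime_ge_2_nat by blast
  have md: "p - 1 = m * d" using assms(3,4) by simp
  have m0: "m > 0" and d0: "d > 0" using md p2 by (auto intro!: Nat.gr0I)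
  have B1: "B \<ge> 1" using p2 by (simp add: B_def)
  have dc: "dchar p c" if "c \<in> Xchars p m" for c using that by (simp add: Xchars_def)
  have "(\<Sum>c\<in>Xchars p m. S c) = real m * W"
    unfolding S_def W_def
  proof (rule sum_dchar_moments[where p = p])
    show "(\<Sum>c\<in>Xchars p m. c a * cnj (c b)) = of_real (real m * I a b)" for a b
      unfolding X(3) I_def by simp
  qed (use X(1) dc in auto)
  moreover have "(\<Sum>c\<in>Xchars p m. S c) = (\<Sum>c\<in>NP. S c) + (\<Sum>c\<in>PR. S c)"
  proof -
    have "Xchars p m = NP \<union> PR" "NP \<inter> PR = {}" by (auto simp: NP_def PR_def)
    then show ?thesis using X(1) by (metis finite_Un sum.union_disjoint)
  qed
  ultimately have WS: "real m * W = (\<Sum>c\<in>NP. S c) + (\<Sum>c\<in>PR. S c)" by simp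
  have "real m * Mnu (2 * real k) p m = (\<Sum>c\<in>NP. L c)"
    using m0 by (simp add: Mnu_def NP_def L_def)
  with WS have "real m * (Mnu (2 * real k) p m - W) = (\<Sum>c\<in>NP. L c - S c) - (\<Sum>c\<in>PR. S c)"
    by (simp add: right_diff_distrib sum_subtractf)
  then have "real m * \<bar>Mnu (2 * real k) p m - W\<bar> = \<bar>(\<Sum>c\<in>NP. L c - S c) - (\<Sum>c\<in>PR. S c)\<bar>"
    by (metis abs_mult abs_of_nat)
  also have "\<dots> \<le> (\<Sum>c\<in>NP. \<bar>L c - S c\<bar>) + (\<Sum>c\<in>PR. \<bar>S c\<bar>)"
    using sum_abs[of "\<lambda>c. L c - S c" NP] sum_abs[of S PR] by linarith
  also have "(\<Sum>c\<in>NP. \<bar>L c - S c\<bar>) \<le> real (card NP) * (4 * real k * B ^ (2 * k) / real p)"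
    unfolding L_def S_def N_def B_def
    by (intro sum_bounded_above dchar_moment_truncation assms) (auto simp: NP_def dc)
  also have "\<dots> \<le> real m * (4 * real k * B ^ (2 * k) / real p)"
  proof (rule mult_right_mono)
    have "card NP \<le> card (Xchars p m)" using X(1) by (intro card_mono) (auto simp: NP_def)
    then show "real (card NP) \<le> real m" using X(2) by simp
  qed (use B1 in auto)
  also have "(\<Sum>c\<in>PR. \<bar>S c\<bar>) \<le> real (card PR) * B ^ (2 * k)"
  proof (rule sum_bounded_above)
    fix c assume c: "c \<in> PR"
    then have "norm (\<Sum>n=1..N. c n / of_nat n) \<le> 1 + ln (real N)"
      using p2 by (intro norm_dchar_sum_le[OF assms(1)] dc) (auto simp: PR_def N_def)
    also have "\<dots> \<le> B" using p2 by (simp add: N_def B_def ln_realpow)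
    finally show "\<bar>S c\<bar> \<le> B ^ (2 * k)" by (simp add: S_def power_mono)
  qed
  also have "\<dots> \<le> 1 * B ^ (2 * k)"
  proof (rule mult_right_mono)
    \<comment> \<open>As functions on the naturals, principal characters modulo p coincide, so at
      most one is removed.\<close>
    have "PR \<subseteq> {\<lambda>n. if p dvd n then 0 else 1}"
      using principal_char_unique[OF _ _ assms(1)] dc by (auto simp: PR_def)
    then have "card PR \<le> card {\<lambda>n. if p dvd n then 0 else 1 :: complex}" by (intro card_mono) auto
    then show "real (card PR) \<le> 1" by simp
  qed (use B1 in auto)
  finally have "real m * \<bar>Mnu (2 * real k) p m - W\<bar> \<le> real m * (4 * real k * B ^ (2 * k) / real p) + B ^ (2 * k)"
    by simp
  then have "\<bar>Mnu (2 * real k) p m - W\<bar> \<le> (real m * (4 * real k * B ^ (2 * k) / real p) + B ^ (2 * k)) / real m"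
    using m0 by (simp add: pos_le_divide_eq mult.commute)
  also have "\<dots> = 4 * real k * B ^ (2 * k) / real p + B ^ (2 * k) * (1 / real m)"
    using m0 by (simp add: add_divide_distrib)
  also have "\<dots> \<le> 4 * real k * B ^ (2 * k) / real p * real d + B ^ (2 * k) * (2 * real d / real p)"
  proof (intro add_mono mult_left_mono)
    have "4 * real k * B ^ (2 * k) / real p * 1 \<le> 4 * real k * B ^ (2 * k) / real p * real d"
      using d0 B1 by (intro mult_left_mono) auto
    then show "4 * real k * B ^ (2 * k) / real p \<le> 4 * real k * B ^ (2 * k) / real p * real d" by simp
    have "p \<le> 2 * (p - 1)" using p2 by simp
    then have "real p \<le> 2 * (real m * real d)" unfolding md by (metis of_nat_le_iff of_nat_mult of_nat_numeral)
    then show "1 / real m \<le> 2 * real d / real p" using m0 p2 by (simp add: field_simps)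
  qed (use B1 in auto)
  also have "\<dots> = (4 * real k + 2) * real d * B ^ (2 * k) / real p"
    by (simp add: add_divide_distrib algebra_simps)
  finally show ?thesis by (simp only: W_def N_def B_def)
qed

text \<open>Odd characters are never principal, so truncation is the only source of error.\<close>

lemma Mnu_minus_close:
  assumes "prime p" "odd p" "m dvd p - 1" "d = (p - 1) div m" "odd d" "k \<ge> 1"
  defines "I \<equiv> \<lambda>a b. if \<not> p dvd a \<and> \<not> p dvd b \<and> [a ^ d = b ^ d] (mod p) then 1 else 0 :: real"
  shows "\<bar>Mnu_minus (2 * real k) p m - (\<Sum>a=1..(p\<^sup>2) ^ k. \<Sum>b=1..(p\<^sup>2) ^ k.
      (real (bounded_tau (p\<^sup>2) k a) / real a) * (real (bounded_tau (p\<^sup>2) k b) / real b) *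
        (I a b - I ((p - 1) * a) b))\<bar>
    \<le> 4 * real k * (3 + 2 * ln (real p)) ^ (2 * k) / real p"
proof -
  note X = Xchars_minus_orthogonality[OF assms(1-5)]
  define N where "N = p\<^sup>2"
  define S where "S c = norm (\<Sum>n=1..N. c n / of_nat n) ^ (2 * k)" for c :: "nat \<Rightarrow> complex"
  define L where "L c = norm (L1 c) powr (2 * real k)" for c
  define B where "B = 3 + 2 * ln (real p)"
  define Y where "Y = Xchars_minus p m"
  define W where "W = (\<Sum>a=1..N ^ k. \<Sum>b=1..N ^ k.
      (real (bounded_tau N k a) / real a) * (real (bounded_tau N k b) / real b) * (I a b - I ((p - 1) * a) b))"
  have p2: "p > 2" using assms(1,2) by (metis even_numeral le_neq_implies_less prime_ge_2_nat)
  have md: "p - 1 = m * d" using assms(3,4) by simp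
  have m0: "m > 0" using md p2 by (auto intro!: Nat.gr0I)
  have dc: "dchar p c" if "c \<in> Y" for c using that by (simp add: Y_def Xchars_minus_def Xchars_def)
  have np: "\<not> principal_char p c" if c: "c \<in> Y" for c
  proof
    assume "principal_char p c"
    moreover have "coprime (p - 1) p" using p2 by (intro coprime_diff_one_left_nat) simp
    ultimately have "c (p - 1) = 1" by (simp add: principal_char_def)
    then show False using c by (simp add: Y_def Xchars_minus_def)
  qed
  have cY: "real (card Y) = real m / 2" "real (card Y) > 0" using X(2) m0 by (auto simp: Y_def)
  have "(\<Sum>c\<in>Y. S c) = real (card Y) * W"
    unfolding S_def W_def
  proof (rule sum_dchar_moments[where p = p])
    show "(\<Sum>c\<in>Y. c a * cnj (c b)) = of_real (real (card Y) * (I a b - I ((p - 1) * a) b))" for a b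
      unfolding cY(1) unfolding Y_def using X(3)[of a b] by (simp only: I_def)
  qed (use X(1) dc in \<open>auto simp: Y_def\<close>)
  moreover have "real (card Y) * Mnu_minus (2 * real k) p m = (\<Sum>c\<in>Y. L c)"
    using cY(2) by (simp add: Mnu_minus_def Y_def[symmetric] L_def)
  ultimately have "real (card Y) * (Mnu_minus (2 * real k) p m - W) = (\<Sum>c\<in>Y. L c - S c)"
    by (simp add: right_diff_distrib sum_subtractf)
  then have "real (card Y) * \<bar>Mnu_minus (2 * real k) p m - W\<bar> = \<bar>\<Sum>c\<in>Y. L c - S c\<bar>"
    by (metis abs_mult abs_of_nat)
  also have "\<dots> \<le> (\<Sum>c\<in>Y. \<bar>L c - S c\<bar>)" by (rule sum_abs)
  also have "\<dots> \<le> real (card Y) * (4 * real k * B ^ (2 * k) / real p)"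
    unfolding L_def S_def N_def B_def
    by (intro sum_bounded_above dchar_moment_truncation assms dc np)
  finally have "\<bar>Mnu_minus (2 * real k) p m - W\<bar> \<le> 4 * real k * B ^ (2 * k) / real p"
    using cY(2) by (simp only: mult_le_cancel_left_pos)
  then show ?thesis by (simp only: W_def N_def B_def)
qed

text \<open>Over the integers the hypothesis reads -(a^d) = b^d, as d is odd. Squaring gives the
  first claim; adding a^d = b^d gives 2 a^d = 0. With b = a the second claim shows that the twisted
  kernel vanishes on the diagonal away from multiples of p.\<close>

lemma neg_power_cong:
  fixes p a b d :: nat
  assumes "prime p" "odd p" "odd d" "[((p - 1) * a) ^ d = b ^ d] (mod p)"
  shows "[a ^ (2 * d) = b ^ (2 * d)] (mod p)" "[a ^ d = b ^ d] (mod p) \<Longrightarrow> p dvd a"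
proof -
  have p2: "p > 2" using assms(1,2) by (metis even_numeral le_neq_implies_less prime_ge_2_nat)
  have "[int ((p - 1) * a) = - int a] (mod int p)"
    using p2 by (simp add: cong_iff_dvd_diff of_nat_diff algebra_simps)
  then have "[int ((p - 1) * a) ^ d = (- int a) ^ d] (mod int p)" by (rule cong_pow)
  moreover have "[int ((p - 1) * a) ^ d = int b ^ d] (mod int p)"
    using assms(4) by (metis cong_int_iff of_nat_power)
  ultimately have neg: "[- (int a ^ d) = int b ^ d] (mod int p)"
    using assms(3) by (metis cong_sym cong_trans power_minus_odd)
  then have "[(- (int a ^ d)) ^ 2 = (int b ^ d) ^ 2] (mod int p)" by (rule cong_pow)
  then have "[int (a ^ (2 * d)) = int (b ^ (2 * d))] (mod int p)"
    by (simp add: power_mult[symmetric] mult.commute)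
  then show "[a ^ (2 * d) = b ^ (2 * d)] (mod p)" by (simp only: cong_int_iff)
  show "p dvd a" if "[a ^ d = b ^ d] (mod p)"
  proof -
    have "[int a ^ d = int b ^ d] (mod int p)" using that by (metis cong_int_iff of_nat_power)
    with neg have "[- (int a ^ d) = int a ^ d] (mod int p)" by (metis cong_sym cong_trans)
    then have "int p dvd - (2 * int a ^ d)" by (simp add: cong_iff_dvd_diff)
    then have "int p dvd int (2 * a ^ d)" by (simp add: dvd_minus_iff)
    then have "p dvd 2 * a ^ d" by (simp only: of_nat_dvd_iff)
    moreover have "\<not> p dvd 2" using p2 by (auto dest: dvd_imp_le)
    ultimately have "p dvd a ^ d" using assms(1) by (simp add: prime_dvd_mult_iff)
    then show "p dvd a" using assms(1) prime_dvd_power_nat by blast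
  qed
qed

lemma moments_close_outside_exceptional_primes:
  fixes k :: nat and \<kappa> :: real
  assumes "k \<ge> 1" "0 \<le> \<kappa>" "\<kappa> < 1"
  shows "\<exists>K>0. \<forall>(D::real) (Q::real) (R::real) p m. R > 0 \<longrightarrow> prime p \<longrightarrow> Q \<le> real p \<longrightarrow> real p \<le> 2 * Q \<longrightarrow>
      p \<notin> exceptional_primes D Q R \<longrightarrow> m dvd p - 1 \<longrightarrow> odd ((p - 1) div m) \<longrightarrow>
      3 \<le> (p - 1) div m \<longrightarrow> real ((p - 1) div m) \<le> D \<longrightarrow>
      \<bar>Mnu (2 * real k) p m - a_const k\<bar> \<le> K * (D * R powr (-\<kappa>) + D * real p powr (-1/2)) \<and>
      \<bar>Mnu_minus (2 * real k) p m - a_const k\<bar> \<le> K * (D * R powr (-\<kappa>) + D * real p powr (-1/2))"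
proof -
  obtain K where K: "K > 0" and close: "\<And>p d R \<delta>. prime p \<Longrightarrow> d > 0 \<Longrightarrow> R > 0 \<Longrightarrow>
    (\<forall>a b. a > 0 \<longrightarrow> b > 0 \<longrightarrow> a \<noteq> b \<longrightarrow> [a ^ (2 * d) = b ^ (2 * d)] (mod p) \<longrightarrow> R < real a * real b) \<Longrightarrow>
    (\<forall>a. \<not> p dvd a \<longrightarrow> \<delta> a a = 1) \<Longrightarrow>
    (\<forall>a b. p dvd a \<or> p dvd b \<longrightarrow> \<delta> a b = 0) \<Longrightarrow>
    (\<forall>a b. a \<noteq> b \<longrightarrow> \<bar>\<delta> a b\<bar> \<le> 1) \<Longrightarrow>
    (\<forall>a b. a \<noteq> b \<longrightarrow> \<not> [a ^ (2 * d) = b ^ (2 * d)] (mod p) \<longrightarrow> \<delta> a b = 0) \<Longrightarrow>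
    \<bar>(\<Sum>a=1..(p\<^sup>2) ^ k. \<Sum>b=1..(p\<^sup>2) ^ k.
        (real (bounded_tau (p\<^sup>2) k a) / real a) * (real (bounded_tau (p\<^sup>2) k b) / real b) * \<delta> a b) - a_const k\<bar>
      \<le> K * real d * (R powr (-\<kappa>) + real p powr (-1/2))"
    using correlation_sum_close[OF assms] by blast
  obtain C where C: "C > 0" "\<And>x::real. x \<ge> 1 \<Longrightarrow> (3 + 2 * ln x) ^ (2 * k) \<le> C * x powr (1 / 2)"
    using affine_ln_power_le_sqrt[of "2 * k"] assms(1) by auto
  define K' where "K' = K + (4 * real k + 2) * C"
  have K': "K' > 0" using K C by (simp add: K'_def add_pos_nonneg)
  have "\<bar>Mnu (2 * real k) p m - a_const k\<bar> \<le> K' * (D * R powr (-\<kappa>) + D * real p powr (-1/2)) \<and>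
      \<bar>Mnu_minus (2 * real k) p m - a_const k\<bar> \<le> K' * (D * R powr (-\<kappa>) + D * real p powr (-1/2))"
    if R: "R > 0" and p: "prime p" "Q \<le> real p" "real p \<le> 2 * Q" and ne: "p \<notin> exceptional_primes D Q R"
      and m: "m dvd p - 1" and d: "odd ((p - 1) div m)" "3 \<le> (p - 1) div m" "real ((p - 1) div m) \<le> D"
    for D Q R :: real and p m :: nat
  proof -
    define d where "d = (p - 1) div m"
    define r where "r = R powr (-\<kappa>)"
    define q where "q = real p powr (-1/2)"
    define B where "B = (3 + 2 * ln (real p)) ^ (2 * k)"
    define I where "I = (\<lambda>a b. if \<not> p dvd a \<and> \<not> p dvd b \<and> [a ^ d = b ^ d] (mod p) then 1 else 0 :: real)"
    define W where "W \<delta> = (\<Sum>a=1..(p\<^sup>2) ^ k. \<Sum>b=1..(p\<^sup>2) ^ k.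
        (real (bounded_tau (p\<^sup>2) k a) / real a) * (real (bounded_tau (p\<^sup>2) k b) / real b) * \<delta> a b)" for \<delta>
    have d0: "odd d" "d > 0" "real d \<le> D" "d \<ge> 3" using d by (auto simp: d_def)
    \<comment> \<open>From d >= 3 one gets p > 3, so p is odd as the character lemmas
      require.\<close>
    have "(p - 1) div m \<le> p - 1" by simp
    then have p2: "p > 2" using d(2) by linarith
    then have podd: "odd p" using p(1) prime_odd_nat by blast
    have rq: "r \<ge> 0" "q \<ge> 0" by (auto simp: r_def q_def)
    have far: "\<forall>a b. a > 0 \<longrightarrow> b > 0 \<longrightarrow> a \<noteq> b \<longrightarrow> [a ^ (2 * d) = b ^ (2 * d)] (mod p) \<longrightarrow> R < real a * real b"
    proof (intro allI impI, rule ccontr)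
      fix a b :: nat
      assume *: "a > 0" "b > 0" "a \<noteq> b" "[a ^ (2 * d) = b ^ (2 * d)] (mod p)" "\<not> R < real a * real b"
      then have "real a * real b \<le> R" by simp
      with * p d0 have "p \<in> exceptional_primes D Q R" unfolding exceptional_primes_def by blast
      with ne show False by simp
    qed
    have sq: "[a ^ (2 * d) = b ^ (2 * d)] (mod p)" if "[a ^ d = b ^ d] (mod p)" for a b
      using cong_pow[OF that, of 2] by (simp add: power_mult[symmetric] mult.commute)
    have 1: "\<bar>W I - a_const k\<bar> \<le> K * real d * (r + q)"
      unfolding W_def r_def q_def
      by (rule close) (use p R d0 far sq in \<open>auto simp: I_def\<close>)
    \<comment> \<open>Same estimate for the kernel of the odd characters; its values are differences
      of two indicators, hence at most 1 in modulus.\<close>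
    have 2: "\<bar>W (\<lambda>a b. I a b - I ((p - 1) * a) b) - a_const k\<bar> \<le> K * real d * (r + q)"
      unfolding W_def r_def q_def
    proof (rule close)
      show "\<forall>a. \<not> p dvd a \<longrightarrow> I a a - I ((p - 1) * a) a = 1"
        using neg_power_cong(2)[OF p(1) podd d0(1)] by (auto simp: I_def)
      show "\<forall>a b. p dvd a \<or> p dvd b \<longrightarrow> I a b - I ((p - 1) * a) b = 0" by (auto simp: I_def)
      show "\<forall>a b. a \<noteq> b \<longrightarrow> \<bar>I a b - I ((p - 1) * a) b\<bar> \<le> 1" by (auto simp: I_def)
      show "\<forall>a b. a \<noteq> b \<longrightarrow> \<not> [a ^ (2 * d) = b ^ (2 * d)] (mod p) \<longrightarrow> I a b - I ((p - 1) * a) b = 0"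
        using neg_power_cong(1)[OF p(1) podd d0(1)] sq by (auto simp: I_def)
    qed (use p R d0 far in auto)
    have "B \<le> C * real p powr (1 / 2)" unfolding B_def using p2 by (intro C) auto
    then have "B / real p \<le> C * real p powr (1 / 2) / real p" by (intro divide_right_mono) auto
    also have "\<dots> = C * q" using p2 powr_diff[of "real p" "1 / 2" 1] by (simp add: q_def)
    finally have Bq: "B / real p \<le> C * q" .
    have B0: "0 \<le> B" using p2 by (simp add: B_def)
    have e1: "(4 * real k + 2) * real d * B / real p \<le> (4 * real k + 2) * C * real d * (r + q)"
    proof -
      have "(4 * real k + 2) * real d * B / real p = (4 * real k + 2) * real d * (B / real p)" by simp
      also have "\<dots> \<le> (4 * real k + 2) * real d * (C * (r + q))"
      proof (rule mult_left_mono)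
        show "B / real p \<le> C * (r + q)" using Bq C(1) rq by (simp add: distrib_left add_increasing)
      qed simp
      finally show ?thesis by (simp add: mult_ac)
    qed
    have e2: "4 * real k * B / real p \<le> (4 * real k + 2) * real d * B / real p"
    proof (intro divide_right_mono mult_right_mono B0)
      have "4 * real k * 1 \<le> (4 * real k + 2) * real d" using d0 by (intro mult_mono) auto
      then show "4 * real k \<le> (4 * real k + 2) * real d" by simp
    qed simp
    have "\<bar>Mnu (2 * real k) p m - W I\<bar> \<le> (4 * real k + 2) * real d * B / real p"
      unfolding W_def I_def B_def by (rule Mnu_close) (use p podd m assms d_def in auto)
    then have M1: "\<bar>Mnu (2 * real k) p m - a_const k\<bar> \<le> K' * real d * (r + q)"
      using 1 e1 unfolding K'_def by (simp add: distrib_right)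
    have "\<bar>Mnu_minus (2 * real k) p m - W (\<lambda>a b. I a b - I ((p - 1) * a) b)\<bar> \<le> 4 * real k * B / real p"
      unfolding W_def I_def B_def by (rule Mnu_minus_close) (use p podd m assms d0 d_def in auto)
    then have M2: "\<bar>Mnu_minus (2 * real k) p m - a_const k\<bar> \<le> K' * real d * (r + q)"
      using 2 e1 e2 unfolding K'_def by (simp add: distrib_right)
    have "K' * real d * (r + q) \<le> K' * D * (r + q)"
      using K' d0 rq by (intro mult_right_mono mult_left_mono) auto
    also have "\<dots> = K' * (D * r + D * q)" by (simp add: algebra_simps)
    finally show ?thesis using M1 M2 unfolding r_def q_def by linarith
  qed
  then show ?thesis using K' by blast
qed

theorem theorem2p5:
  fixes \<kappa> :: real and k :: nat
  assumes "\<kappa> < 1" and "k \<ge> 1"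
  shows "\<exists>C1 C2 :: real. \<exists>\<epsilon> :: nat \<Rightarrow> real. C1 > 0 \<and> C2 > 0 \<and> \<epsilon> \<longlonglongrightarrow> 0 \<and>
    (\<forall>D Q R :: real. D \<ge> 2 \<longrightarrow> Q \<ge> 2 \<longrightarrow> R \<ge> 2 \<longrightarrow>
      real (card {p :: nat. prime p \<and> Q \<le> real p \<and> real p \<le> 2 * Q \<and>
        \<not> (\<forall>m. m dvd p - 1 \<longrightarrow> odd ((p - 1) div m) \<longrightarrow>
               3 \<le> (p - 1) div m \<longrightarrow> real ((p - 1) div m) \<le> D \<longrightarrow>
               \<bar>Mnu (2 * real k) p m - a_const k\<bar>
                 \<le> C2 * (D * R powr (-\<kappa>) + D * real p powr (-1/2 + \<epsilon> p)) \<and>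
               \<bar>Mnu_minus (2 * real k) p m - a_const k\<bar>
                 \<le> C2 * (D * R powr (-\<kappa>) + D * real p powr (-1/2 + \<epsilon> p)))})
      \<le> C1 * D\<^sup>2 * R * (ln R)\<^sup>2 / ln D)"
proof -
  \<comment> \<open>The lattice estimates assume a nonnegative exponent. For negative \<kappa> the
    bound with exponent 0 is stronger, since R >= 1.\<close>
  define \<kappa>' where "\<kappa>' = max \<kappa> 0"
  have \<kappa>': "0 \<le> \<kappa>'" "\<kappa>' < 1" "\<kappa> \<le> \<kappa>'" using assms by (auto simp: \<kappa>'_def)
  obtain K where K: "K > 0" and close: "\<And>D Q R p m. R > 0 \<Longrightarrow> prime p \<Longrightarrow> Q \<le> real p \<Longrightarrow> real p \<le> 2 * Q \<Longrightarrow>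
      p \<notin> exceptional_primes D Q R \<Longrightarrow> m dvd p - 1 \<Longrightarrow> odd ((p - 1) div m) \<Longrightarrow>
      3 \<le> (p - 1) div m \<Longrightarrow> real ((p - 1) div m) \<le> D \<Longrightarrow>
      \<bar>Mnu (2 * real k) p m - a_const k\<bar> \<le> K * (D * R powr (-\<kappa>') + D * real p powr (-1/2)) \<and>
      \<bar>Mnu_minus (2 * real k) p m - a_const k\<bar> \<le> K * (D * R powr (-\<kappa>') + D * real p powr (-1/2))"
    using moments_close_outside_exceptional_primes[OF assms(2) \<kappa>'(1,2)] by blast
  have "real (card {p :: nat. prime p \<and> Q \<le> real p \<and> real p \<le> 2 * Q \<and>
        \<not> (\<forall>m. m dvd p - 1 \<longrightarrow> odd ((p - 1) div m) \<longrightarrow>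
               3 \<le> (p - 1) div m \<longrightarrow> real ((p - 1) div m) \<le> D \<longrightarrow>
               \<bar>Mnu (2 * real k) p m - a_const k\<bar>
                 \<le> K * (D * R powr (-\<kappa>) + D * real p powr (-1/2 + 0)) \<and>
               \<bar>Mnu_minus (2 * real k) p m - a_const k\<bar>
                 \<le> K * (D * R powr (-\<kappa>) + D * real p powr (-1/2 + 0)))})
      \<le> 12 * D\<^sup>2 * R * (ln R)\<^sup>2 / ln D" (is "real (card ?A) \<le> _")
    if DQR: "D \<ge> 2" "Q \<ge> 2" "R \<ge> 2" for D Q R :: real
  proof -
    have "R powr (-\<kappa>') \<le> R powr (-\<kappa>)" using \<kappa>' DQR by (intro powr_mono) auto
    then have le: "K * (D * R powr (-\<kappa>') + D * real p powr (-1/2)) \<le> K * (D * R powr (-\<kappa>) + D * real p powr (-1/2))" for p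
      using K DQR by (intro mult_left_mono add_right_mono) auto
    have "?A \<subseteq> exceptional_primes D Q R"
    proof (rule subsetI, rule ccontr)
      fix p assume p: "p \<in> ?A" and ne: "p \<notin> exceptional_primes D Q R"
      then obtain m where m: "m dvd p - 1" "odd ((p - 1) div m)" "3 \<le> (p - 1) div m" "real ((p - 1) div m) \<le> D"
        and bad: "\<not> (\<bar>Mnu (2 * real k) p m - a_const k\<bar> \<le> K * (D * R powr (-\<kappa>) + D * real p powr (-1/2 + 0)) \<and>
          \<bar>Mnu_minus (2 * real k) p m - a_const k\<bar> \<le> K * (D * R powr (-\<kappa>) + D * real p powr (-1/2 + 0)))"
        unfolding mem_Collect_eq by blast
      have "prime p" "Q \<le> real p" "real p \<le> 2 * Q" using p by auto
      with close[OF _ _ _ _ ne m] DQR le[of p] bad show False by auto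
    qed
    \<comment> \<open>Monotonicity of \<open>card\<close> requires finiteness, as an infinite set
      would have cardinality 0.\<close>
    moreover have "finite (exceptional_primes D Q R)"
      by (rule finite_subset[of _ "{..nat \<lfloor>2 * Q\<rfloor>}"]) (auto simp: exceptional_primes_def le_nat_floor)
    ultimately have "card ?A \<le> card (exceptional_primes D Q R)" by (intro card_mono)
    then show ?thesis using card_exceptional_primes_le[OF DQR] by linarith
  qed
  then show ?thesis
    using K by (intro exI[of _ 12] exI[of _ K] exI[of _ "\<lambda>_. 0"]) auto
qed

end
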